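(* There exist a Markov automaton $\mathcal{M}$, objectives $\mathbb{O}=(O_1,\dots,O_d)$ (timed or untimed reachability objectives) and threshold relations $\rhd$ such that the convex set $\{p\in\mathbb{R}^d\mid\mathrm{achieve}^{\mathcal{M}}(\mathbb{O}\rhd p)\}$ is not a finite polytope, i.e., it cannot be represented by a finite number of vertices.
   Context: A Markov automaton (MA) is a tuple $\mathcal{M}=(S,\mathit{Act},\to,s_0,\{\rho_1,\dots,\rho_\ell\})$ with $S$ a finite set of states, $s_0$ the initial state, $\mathit{Act}$ a finite action set containing $\bot$, transitions $\to\subseteq S\times(\mathit{Act}\,\dot\cup\,\mathbb{R}_{>0})\times\mathrm{Dist}(S)$ with at most one rate-labelled (Markovian) transition per state, and reward functions. Standing assumptions: action-determinism, every state has an outgoing transition, maximal progress ($S=PS\,\dot\cup\,MS$), non-Zenoness. Paths record actions taken at probabilistic states and (exponentially distributed, with the exit rate $E(s)$) sojourn times at Markovian states. A generic scheduler maps each finite path (including sojourn times) to a distribution over the enabled actions of its last state, inducing a probability measure $\Pr^{\mathcal{M}}_\sigma$ on infinite paths. A reachability objective $\mathbb{P}(\Diamond^IG)$ ($I=[a,b]$ or $[a,\infty)$ with $0\le a<b$, $G\subseteq S$) has value $\Pr^{\mathcal{M}}_\sigma(\Diamond^IG)$, the probability of being in a $G$-state at some time point in $I$; untimed if $I=[0,\infty)$. For thresholds $\rhd=(\rhd_1,\dots,\rhd_d)\in\{<,\le,>,\ge\}^d$ and $p\in\mathbb{R}^d$, $\mathrm{achieve}^{\mathcal{M}}(\mathbb{O}\rhd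 p)$ holds iff some generic scheduler $\sigma$ makes the value of each $O_i$ satisfy $\rhd_ip_i$. *)

theory Defs
  imports "HOL-Probability.Probability" "HOL-Analysis.Finite_Function_Topology"
begin

record ('s, 'a) ma =
  states :: "'s set"
  acts :: "'a set"
  bot_act :: 'a
  transitions :: "('s \<times> ('a + real) \<times> 's pmf) set"
  init :: 's
  rewards :: "('s + 's \<times> 'a \<Rightarrow> real) list"

definition probabilistic_states :: "('s, 'a) ma \<Rightarrow> 's set" where
  "probabilistic_states M = {s. \<exists>\<alpha> \<mu>. (s, Inl \<alpha>, \<mu>) \<in> transitions M}"

definition markovian_states :: "('s, 'a) ma \<Rightarrow> 's set" where
  "markovian_states M = {s. \<exists>r \<mu>. (s, Inr r, \<mu>) \<in> transitions M}"

definition exit_rate :: "('s, 'a) ma \<Rightarrow> 's \<Rightarrow> real" where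
  "exit_rate M s = (THE r. \<exists>\<mu>. (s, Inr r, \<mu>) \<in> transitions M)"

text \<open>Markovian transitions are addressed through the action \<open>\<bottom>\<close>, the only action enabled in a
  Markovian state.\<close>

definition moves :: "('s, 'a) ma \<Rightarrow> 's \<Rightarrow> 'a \<Rightarrow> 's pmf \<Rightarrow> bool" where
  "moves M s \<alpha> \<mu> \<longleftrightarrow>
     (s, Inl \<alpha>, \<mu>) \<in> transitions M \<or> (\<alpha> = bot_act M \<and> (\<exists>r. (s, Inr r, \<mu>) \<in> transitions M))"

definition enabled :: "('s, 'a) ma \<Rightarrow> 's \<Rightarrow> 'a set" where
  "enabled M s = {\<alpha>. \<exists>\<mu>. moves M s \<alpha> \<mu>}"

definition succ_dist :: "('s, 'a) ma \<Rightarrow> 's \<Rightarrow> 'a \<Rightarrow> 's pmf" where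
  "succ_dist M s \<alpha> = (THE \<mu>. moves M s \<alpha> \<mu>)"

text \<open>A path \<open>s\<^sub>0 \<kappa>\<^sub>0 s\<^sub>1 \<kappa>\<^sub>1 \<dots>\<close> from the initial state is the sequence of its steps
  \<open>(\<kappa>\<^sub>0, s\<^sub>1), (\<kappa>\<^sub>1, s\<^sub>2), \<dots>\<close>. A stamp is a pair of an action and a sojourn time: \<open>(\<alpha>, 0)\<close> when the
  action \<open>\<alpha>\<close> is taken in a probabilistic state, and \<open>(\<bottom>, t)\<close> when a Markovian state is left after
  time \<open>t\<close>. As every state is either probabilistic or Markovian, this loses nothing with
  respect to stamps in the disjoint union of actions and nonnegative reals.\<close>

type_synonym ('s, 'a) step = "'a \<times> real \<times> 's"

definition step_space :: "('s, 'a) step measure" where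
  "step_space = count_space UNIV \<Otimes>\<^sub>M (borel \<Otimes>\<^sub>M count_space UNIV)"

fun path_from :: "('s, 'a) ma \<Rightarrow> 's \<Rightarrow> ('s, 'a) step list \<Rightarrow> bool" where
  "path_from M s [] \<longleftrightarrow> True"
| "path_from M s ((\<alpha>, t, s') # xs) \<longleftrightarrow>
     \<alpha> \<in> enabled M s \<and> (if s \<in> markovian_states M then 0 \<le> t else t = 0) \<and>
     s' \<in> set_pmf (succ_dist M s \<alpha>) \<and> path_from M s' xs"

definition last_state :: "('s, 'a) ma \<Rightarrow> ('s, 'a) step list \<Rightarrow> 's" where
  "last_state M xs = (if xs = [] then init M else snd (snd (last xs)))"

text \<open>Schedulers are total functions on lists of steps. Their values on lists that are not
  finite paths are irrelevant for the induced measure; since the finite paths form a measurable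
  set, asking for measurability on all lists of a given length is no restriction.\<close>

definition generic_scheduler :: "('s, 'a) ma \<Rightarrow> (('s, 'a) step list \<Rightarrow> 'a pmf) \<Rightarrow> bool" where
  "generic_scheduler M \<sigma> \<longleftrightarrow>
     (\<forall>n \<alpha>. (\<lambda>\<omega>. pmf (\<sigma> (map \<omega> [0..<n])) \<alpha>) \<in> borel_measurable (PiM {0..<n} (\<lambda>_. step_space))) \<and>
     (\<forall>xs. path_from M (init M) xs \<longrightarrow> set_pmf (\<sigma> xs) \<subseteq> enabled M (last_state M xs))"

definition state_at :: "('s, 'a) ma \<Rightarrow> (nat \<Rightarrow> ('s, 'a) step) \<Rightarrow> nat \<Rightarrow> 's" where
  "state_at M \<omega> n = (case n of 0 \<Rightarrow> init M | Suc m \<Rightarrow> snd (snd (\<omega> m)))"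

definition time_at :: "(nat \<Rightarrow> ('s, 'a) step) \<Rightarrow> nat \<Rightarrow> real" where
  "time_at \<omega> n = (\<Sum>i<n. fst (snd (\<omega> i)))"

definition step_kernel ::
    "('s, 'a) ma \<Rightarrow> (('s, 'a) step list \<Rightarrow> 'a pmf) \<Rightarrow> nat \<Rightarrow> (nat \<Rightarrow> ('s, 'a) step) \<Rightarrow> ('s, 'a) step measure" where
  "step_kernel M \<sigma> n \<omega> =
     (let s = state_at M \<omega> n in
      if s \<in> markovian_states M then
        distr (density lborel (exponential_density (exit_rate M s)) \<Otimes>\<^sub>M
               measure_pmf (succ_dist M s (bot_act M)))
          step_space (\<lambda>(t, s'). (bot_act M, t, s'))
      else
        distr (measure_pmf (do {\<alpha> \<leftarrow> \<sigma> (map \<omega> [0..<n]); s' \<leftarrow> succ_dist M s \<alpha>;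
                                return_pmf (\<alpha>, 0, s')}))
          step_space (\<lambda>x. x))"

text \<open>The measure on infinite paths given by the Ionescu-Tulcea extension of the step kernels.\<close>

definition path_measure ::
    "('s, 'a) ma \<Rightarrow> (('s, 'a) step list \<Rightarrow> 'a pmf) \<Rightarrow> (nat \<Rightarrow> ('s, 'a) step) measure" where
  "path_measure M \<sigma> =
     projective_family.lim UNIV (Ionescu_Tulcea.CI (step_kernel M \<sigma>) (\<lambda>_. step_space)) (\<lambda>_. step_space)"

text \<open>The last conjunct is non-Zenoness: almost surely, time diverges.\<close>

definition markov_automaton :: "('s, 'a) ma \<Rightarrow> bool" where
  "markov_automaton M \<longleftrightarrow>
     finite (states M) \<and> init M \<in> states M \<and> finite (acts M) \<and> bot_act M \<in> acts M \<and>
     transitions M \<subseteq> states M \<times> (acts M <+> {0<..}) \<times> {\<mu>. set_pmf \<mu> \<subseteq> states M} \<and>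
     (\<forall>s r r' \<mu> \<mu>'. (s, Inr r, \<mu>) \<in> transitions M \<and> (s, Inr r', \<mu>') \<in> transitions M \<longrightarrow> r = r' \<and> \<mu> = \<mu>') \<and>
     (\<forall>\<rho>\<in>set (rewards M). \<forall>x\<in>states M <+> states M \<times> acts M. 0 \<le> \<rho> x) \<and>
     (\<forall>s \<alpha> \<mu> \<mu>'. (s, Inl \<alpha>, \<mu>) \<in> transitions M \<and> (s, Inl \<alpha>, \<mu>') \<in> transitions M \<longrightarrow> \<mu> = \<mu>') \<and>
     states M = probabilistic_states M \<union> markovian_states M \<and> probabilistic_states M \<inter> markovian_states M = {} \<and>
     (\<forall>\<sigma>. generic_scheduler M \<sigma> \<longrightarrow>
        (AE \<omega> in path_measure M \<sigma>. filterlim (time_at \<omega>) at_top sequentially))"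

text \<open>A reachability objective is a pair of a time interval and a set of goal states. The
  \<open>n\<close>-th state of a path is occupied during the closed interval from \<open>time_at \<omega> n\<close> to
  \<open>time_at \<omega> (Suc n)\<close>, a single point for a probabilistic state.\<close>

definition reach_objective :: "('s, 'a) ma \<Rightarrow> real set \<times> 's set \<Rightarrow> bool" where
  "reach_objective M = (\<lambda>(I, G).
     (\<exists>a\<ge>0. I = {a..} \<or> (\<exists>b>a. I = {a..b})) \<and> G \<subseteq> states M)"

definition reach_paths :: "('s, 'a) ma \<Rightarrow> real set \<Rightarrow> 's set \<Rightarrow> (nat \<Rightarrow> ('s, 'a) step) set" where
  "reach_paths M I G =
     {\<omega>. \<exists>n. state_at M \<omega> n \<in> G \<and> I \<inter> {time_at \<omega> n..time_at \<omega> (Suc n)} \<noteq> {}}"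

definition reach_value ::
    "('s, 'a) ma \<Rightarrow> (('s, 'a) step list \<Rightarrow> 'a pmf) \<Rightarrow> real set \<times> 's set \<Rightarrow> real" where
  "reach_value M \<sigma> = (\<lambda>(I, G). measure (path_measure M \<sigma>) (reach_paths M I G))"

text \<open>The space \<open>\<real>\<^sup>d\<close> is represented as the subspace of those \<open>p :: nat \<Rightarrow>\<^sub>0 real\<close> with
  \<open>keys p \<subseteq> {..<d}\<close>, so that \<open>d\<close> may be quantified; indices run from \<open>0\<close>.\<close>

definition achieve ::
    "('s, 'a) ma \<Rightarrow> nat \<Rightarrow> (nat \<Rightarrow> real set \<times> 's set) \<Rightarrow> (nat \<Rightarrow> real \<Rightarrow> real \<Rightarrow> bool) \<Rightarrow>
     (nat \<Rightarrow>\<^sub>0 real) \<Rightarrow> bool" where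
  "achieve M d Os rel p \<longleftrightarrow>
     (\<exists>\<sigma>. generic_scheduler M \<sigma> \<and> (\<forall>i<d. rel i (reach_value M \<sigma> (Os i)) (Poly_Mapping.lookup p i)))"

definition achievable ::
    "('s, 'a) ma \<Rightarrow> nat \<Rightarrow> (nat \<Rightarrow> real set \<times> 's set) \<Rightarrow> (nat \<Rightarrow> real \<Rightarrow> real \<Rightarrow> bool) \<Rightarrow>
     (nat \<Rightarrow>\<^sub>0 real) set" where
  "achievable M d Os rel = {p. Poly_Mapping.keys p \<subseteq> {..<d} \<and> achieve M d Os rel p}"

text \<open>Sets of achievable points are unbounded, as thresholds can always be relaxed, and need not
  be closed, as thresholds may be strict. Hence a representation by finitely many vertices \<open>V\<close> may
  use finitely many directions \<open>D\<close> in addition, and it is only required up to boundary points;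
  otherwise sets such as a half-line would fail to be finite polytopes for trivial reasons.\<close>

definition finite_polytope :: "'a::real_normed_vector set \<Rightarrow> bool" where
  "finite_polytope X \<longleftrightarrow>
     (\<exists>V D. finite V \<and> finite D \<and>
        closure X = {v + r | v r. v \<in> convex hull V \<and> r \<in> convex_cone hull D})"


lemma measurable_state_at:
  assumes "n \<le> m"
  shows "(\<lambda>\<omega>. state_at M \<omega> n) \<in> PiM {0..<m} (\<lambda>_. step_space) \<rightarrow>\<^sub>M count_space UNIV"
proof (cases n)
  case 0
  then show ?thesis by (simp add: state_at_def)
next
  case (Suc k)
  then have "k \<in> {0..<m}" using assms by simp
  then have [measurable]: "(\<lambda>\<omega>. \<omega> k) \<in> PiM {0..<m} (\<lambda>_. step_space) \<rightarrow>\<^sub>M (step_space :: ('s, 'a) step measure)"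
    by (rule measurable_component_singleton)
  have [measurable]: "(\<lambda>x. snd (snd x)) \<in> (step_space :: ('s, 'a) step measure) \<rightarrow>\<^sub>M count_space UNIV"
    unfolding step_space_def by measurable
  show ?thesis by (simp add: state_at_def Suc)
qed

lemma prob_space_step_kernel:
  assumes "markov_automaton M"
  shows "prob_space (step_kernel M \<sigma> n \<omega>)"
proof (cases "state_at M \<omega> n \<in> markovian_states M")
  case True
  let ?s = "state_at M \<omega> n"
  from True obtain r \<mu> where r: "(?s, Inr r, \<mu>) \<in> transitions M" by (auto simp: markovian_states_def)
  have tr: "transitions M \<subseteq> states M \<times> (acts M <+> {0<..}) \<times> {\<mu>. set_pmf \<mu> \<subseteq> states M}"
    and un: "\<forall>s r r' \<mu> \<mu>'. (s, Inr r, \<mu>) \<in> transitions M \<and> (s, Inr r', \<mu>') \<in> transitions M \<longrightarrow> r = r' \<and> \<mu> = \<mu>'"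
    using assms unfolding markov_automaton_def by - (elim conjE, assumption)+
  have "exit_rate M ?s = r"
    unfolding exit_rate_def using r un by (intro the_equality) blast+
  moreover have "0 < r" using subsetD[OF tr r] by auto
  ultimately have "prob_space (density lborel (exponential_density (exit_rate M ?s)))"
    using prob_space_exponential_density by simp
  then interpret pair_prob_space "density lborel (exponential_density (exit_rate M ?s))"
      "measure_pmf (succ_dist M ?s (bot_act M))"
    by (simp add: pair_prob_space_def pair_sigma_finite_def prob_space_imp_sigma_finite
        measure_pmf.prob_space_axioms)
  have "(\<lambda>(t, s'). (bot_act M, t, s')) \<in>
      density lborel (exponential_density (exit_rate M ?s)) \<Otimes>\<^sub>M measure_pmf (succ_dist M ?s (bot_act M))
      \<rightarrow>\<^sub>M step_space"
    unfolding step_space_def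
    by (subst measurable_cong_sets[OF sets_pair_measure_cong[OF sets_density sets_measure_pmf_count_space] refl]) measurable
  with True show ?thesis
    unfolding step_kernel_def by (simp add: Let_def prob_space_distr)
next
  case False
  then show ?thesis
    unfolding step_kernel_def
    by (auto intro!: measure_pmf.prob_space_distr simp: Let_def step_space_def space_pair_measure)
qed

lemma measurable_step_kernel:
  fixes M :: "('s::countable, 'a::countable) ma"
  assumes M: "markov_automaton M" and \<sigma>: "generic_scheduler M \<sigma>"
  shows "step_kernel M \<sigma> n \<in> PiM {0..<n} (\<lambda>_. step_space) \<rightarrow>\<^sub>M subprob_algebra step_space"
proof (rule measurable_subprob_algebra)
  fix \<omega> :: "nat \<Rightarrow> ('s, 'a) step"
  show "subprob_space (step_kernel M \<sigma> n \<omega>)"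
    using prob_space_step_kernel[OF M] by (rule prob_space_imp_subprob_space)
  show "sets (step_kernel M \<sigma> n \<omega>) = sets step_space"
    by (simp add: step_kernel_def Let_def)
next
  fix A :: "('s, 'a) step set"
  assume A: "A \<in> sets step_space"
  let ?P = "PiM {0..<n} (\<lambda>_. step_space :: ('s, 'a) step measure)"
  note [measurable] = measurable_state_at[OF order_refl, of M n]
  have p[measurable]: "(\<lambda>\<omega>. pmf (\<sigma> (map \<omega> [0..<n])) \<alpha>) \<in> borel_measurable ?P" for \<alpha>
    using \<sigma> by (simp add: generic_scheduler_def)
  have "(\<lambda>\<omega>. emeasure (step_kernel M \<sigma> n \<omega>) A) = (\<lambda>\<omega>.
      if state_at M \<omega> n \<in> markovian_states M
      then emeasure (distr (density lborel (exponential_density (exit_rate M (state_at M \<omega> n))) \<Otimes>\<^sub>M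
               measure_pmf (succ_dist M (state_at M \<omega> n) (bot_act M)))
          step_space (\<lambda>(t, s'). (bot_act M, t, s'))) A
      else \<integral>\<^sup>+\<alpha>. ennreal (pmf (\<sigma> (map \<omega> [0..<n])) \<alpha>) *
           emeasure (measure_pmf (succ_dist M (state_at M \<omega> n) \<alpha>)) {s'. (\<alpha>, 0, s') \<in> A} \<partial>count_space UNIV)"
    (is "_ = (\<lambda>\<omega>. if ?c \<omega> then ?f (state_at M \<omega> n) else \<integral>\<^sup>+\<alpha>. ?g \<omega> \<alpha> * ?h (state_at M \<omega> n) \<alpha> \<partial>_)")
  proof
    fix \<omega>
    have "emeasure (measure_pmf (do {\<alpha> \<leftarrow> \<sigma> (map \<omega> [0..<n]); s' \<leftarrow> succ_dist M (state_at M \<omega> n) \<alpha>;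
        return_pmf (\<alpha>, 0, s')})) A =
      (\<integral>\<^sup>+\<alpha>. emeasure (measure_pmf (do {s' \<leftarrow> succ_dist M (state_at M \<omega> n) \<alpha>;
        return_pmf (\<alpha>, 0, s')})) A \<partial>measure_pmf (\<sigma> (map \<omega> [0..<n])))"
      by (simp add: emeasure_bind_pmf)
    also have "\<dots> = (\<integral>\<^sup>+\<alpha>. ?h (state_at M \<omega> n) \<alpha> \<partial>measure_pmf (\<sigma> (map \<omega> [0..<n])))"
    proof (rule nn_integral_cong)
      fix \<alpha>
      have "(do {s' \<leftarrow> succ_dist M (state_at M \<omega> n) \<alpha>; return_pmf (\<alpha>, 0, s')}) =
          map_pmf (\<lambda>s'. (\<alpha>, 0::real, s')) (succ_dist M (state_at M \<omega> n) \<alpha>)"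
        by (simp add: map_pmf_def)
      then show "emeasure (measure_pmf (do {s' \<leftarrow> succ_dist M (state_at M \<omega> n) \<alpha>;
        return_pmf (\<alpha>, 0, s')})) A = ?h (state_at M \<omega> n) \<alpha>"
        by (simp add: vimage_def)
    qed
    also have "\<dots> = (\<integral>\<^sup>+\<alpha>. ?g \<omega> \<alpha> * ?h (state_at M \<omega> n) \<alpha> \<partial>count_space UNIV)"
      by (rule nn_integral_measure_pmf)
    finally have *: "emeasure (measure_pmf (do {\<alpha> \<leftarrow> \<sigma> (map \<omega> [0..<n]); s' \<leftarrow> succ_dist M (state_at M \<omega> n) \<alpha>;
        return_pmf (\<alpha>, 0, s')})) A = (\<integral>\<^sup>+\<alpha>. ?g \<omega> \<alpha> * ?h (state_at M \<omega> n) \<alpha> \<partial>count_space UNIV)" .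
    have **: "emeasure (distr (measure_pmf q) step_space (\<lambda>x. x)) A = emeasure (measure_pmf q) A" for q
      using A by (subst emeasure_distr) (auto simp: step_space_def space_pair_measure)
    show "emeasure (step_kernel M \<sigma> n \<omega>) A =
        (if ?c \<omega> then ?f (state_at M \<omega> n) else \<integral>\<^sup>+\<alpha>. ?g \<omega> \<alpha> * ?h (state_at M \<omega> n) \<alpha> \<partial>count_space UNIV)"
      unfolding step_kernel_def Let_def if_distrib[of "\<lambda>m. emeasure m A"] ** * ..
  qed
  also have "\<dots> \<in> borel_measurable ?P"
  proof (rule measurable_If)
    show "(\<lambda>\<omega>. ?f (state_at M \<omega> n)) \<in> borel_measurable ?P"
      by (rule measurable_compose[OF measurable_state_at[OF order_refl]]) simp
    have "(\<lambda>\<omega>. ?g \<omega> \<alpha> * ?h (state_at M \<omega> n) \<alpha>) \<in> borel_measurable ?P" for \<alpha>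
    proof (rule borel_measurable_times_ennreal)
      show "(\<lambda>\<omega>. ?h (state_at M \<omega> n) \<alpha>) \<in> borel_measurable ?P"
        by (rule measurable_compose[OF measurable_state_at[OF order_refl]]) simp
    qed measurable
    then have *: "(\<lambda>x. ?g (fst x) \<alpha> * ?h (state_at M (fst x) n) \<alpha>) \<in>
        borel_measurable (?P \<Otimes>\<^sub>M (count_space UNIV :: 'a measure))" for \<alpha>
      by (rule measurable_compose[OF measurable_fst])
    have "case_prod (\<lambda>\<omega> \<alpha>. ?g \<omega> \<alpha> * ?h (state_at M \<omega> n) \<alpha>) \<in>
        borel_measurable (?P \<Otimes>\<^sub>M count_space UNIV)"
      using measurable_compose_countable[OF * measurable_snd] by (simp add: split_beta')
    then show "(\<lambda>\<omega>. \<integral>\<^sup>+\<alpha>. ?g \<omega> \<alpha> * ?h (state_at M \<omega> n) \<alpha> \<partial>count_space UNIV) \<in> borel_measurable ?P"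
      by (intro sigma_finite_measure.borel_measurable_nn_integral sigma_finite_measure_count_space)
    show "{\<omega> \<in> space ?P. ?c \<omega>} \<in> sets ?P"
      by measurable
  qed
  finally show "(\<lambda>\<omega>. emeasure (step_kernel M \<sigma> n \<omega>) A) \<in> borel_measurable ?P" .
qed

lemma Ionescu_Tulcea_step_kernel:
  fixes M :: "('s::countable, 'a::countable) ma"
  assumes "markov_automaton M" and "generic_scheduler M \<sigma>"
  shows "Ionescu_Tulcea (step_kernel M \<sigma>) (\<lambda>_. step_space)"
  using measurable_step_kernel[OF assms] prob_space_step_kernel[OF assms(1)]
  by (intro Ionescu_Tulcea.intro)

lemma
  fixes M :: "('s::countable, 'a::countable) ma"
  assumes "markov_automaton M" and "generic_scheduler M \<sigma>"
  shows sets_path_measure: "sets (path_measure M \<sigma>) = sets (PiM UNIV (\<lambda>_. step_space))"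
    and prob_space_path_measure: "prob_space (path_measure M \<sigma>)"
    and distr_path_measure: "finite J \<Longrightarrow>
      distr (path_measure M \<sigma>) (PiM J (\<lambda>_. step_space)) (\<lambda>\<omega>. restrict \<omega> J) =
      Ionescu_Tulcea.CI (step_kernel M \<sigma>) (\<lambda>_. step_space) J"
proof -
  interpret IT: Ionescu_Tulcea "step_kernel M \<sigma>" "\<lambda>_. step_space"
    by (rule Ionescu_Tulcea_step_kernel[OF assms])
  show *: "sets (path_measure M \<sigma>) = sets (PiM UNIV (\<lambda>_. step_space))"
    by (simp add: path_measure_def)
  show **: "distr (path_measure M \<sigma>) (PiM J (\<lambda>_. step_space)) (\<lambda>\<omega>. restrict \<omega> J) =
      Ionescu_Tulcea.CI (step_kernel M \<sigma>) (\<lambda>_. step_space) J" if "finite J" for J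
    unfolding path_measure_def by (rule IT.distr_lim[OF that])
  show "prob_space (path_measure M \<sigma>)"
  proof (rule prob_space_distrD)
    show "(\<lambda>\<omega>. restrict \<omega> {}) \<in> path_measure M \<sigma> \<rightarrow>\<^sub>M PiM {} (\<lambda>_. step_space)"
      by (subst measurable_cong_sets[OF * refl]) (auto intro!: measurable_restrict)
    show "prob_space (distr (path_measure M \<sigma>) (PiM {} (\<lambda>_. step_space)) (\<lambda>\<omega>. restrict \<omega> {}))"
      using IT.PF.prob_space_P[of "{}"] by (simp add: **)
  qed
qed

lemma sets_reach_paths:
  fixes M :: "('s::countable, 'a::countable) ma"
  assumes "reach_objective M (I, G)"
  shows "reach_paths M I G \<in> sets (PiM UNIV (\<lambda>_. step_space))"
proof -
  let ?P = "PiM UNIV (\<lambda>_. step_space :: ('s, 'a) step measure)"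
  have [measurable]: "(\<lambda>x. snd (snd x)) \<in> (step_space :: ('s, 'a) step measure) \<rightarrow>\<^sub>M count_space UNIV"
    "(\<lambda>x. fst (snd x)) \<in> borel_measurable (step_space :: ('s, 'a) step measure)"
    unfolding step_space_def by measurable
  have [measurable]: "(\<lambda>\<omega>. state_at M \<omega> n) \<in> ?P \<rightarrow>\<^sub>M count_space UNIV" for n
    by (cases n) (simp_all add: state_at_def)
  have [measurable]: "(\<lambda>\<omega>. time_at \<omega> n) \<in> borel_measurable ?P" for n
    unfolding time_at_def by measurable
  have space: "space ?P = UNIV"
    by (simp add: space_PiM step_space_def space_pair_measure)
  obtain a where "I = {a..} \<or> (\<exists>b. I = {a..b})"
    using assms by (auto simp: reach_objective_def)
  then show ?thesis
  proof (elim disjE exE)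
    assume I: "I = {a..}"
    have "I \<inter> {x..y} \<noteq> {} \<longleftrightarrow> x \<le> y \<and> a \<le> y" for x y
      by (auto simp: I intro!: exI[of _ y])
    then have "reach_paths M I G = {\<omega> \<in> space ?P. \<exists>n. state_at M \<omega> n \<in> G \<and>
        time_at \<omega> n \<le> time_at \<omega> (Suc n) \<and> a \<le> time_at \<omega> (Suc n)}"
      by (simp add: reach_paths_def space)
    also have "\<dots> \<in> sets ?P"
      by (intro sets.sets_Collect_countable_Ex sets.sets_Collect_conj borel_measurable_le) measurable
    finally show ?thesis .
  next
    fix b assume I: "I = {a..b}"
    have "reach_paths M I G = {\<omega> \<in> space ?P. \<exists>n. state_at M \<omega> n \<in> G \<and>
        max a (time_at \<omega> n) \<le> min b (time_at \<omega> (Suc n))}"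
      by (auto simp: reach_paths_def space I)
    also have "\<dots> \<in> sets ?P"
      by (intro sets.sets_Collect_countable_Ex sets.sets_Collect_conj borel_measurable_le) measurable
    finally show ?thesis .
  qed
qed

end

theory Submission
  imports Defs
begin

text \<open>
  An exponential clock of rate 1 runs out at a random time \<open>t\<close>; then the scheduler decides, with a
  probability \<open>b t\<close> that may depend on \<open>t\<close>, whether to enter a state \<open>3\<close> that is left again at
  rate 1. The two objectives are to visit state \<open>3\<close> at all, which should have small probability, and
  to be in state \<open>3\<close> at some time \<open>\<ge> 1\<close>, which should have large probability. Their values are
  \<open>\<integral> b t e\<^sup>-\<^sup>t dt\<close> and \<open>\<integral> b t e\<^sup>-\<^sup>t min 1 e\<^sup>t\<^sup>-\<^sup>1 dt\<close>, so it is best to enter late: for \<open>c \<in> [0, 1]\<close> the rule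
  to enter iff \<open>t \<ge> c\<close> gives the point \<open>(e\<^sup>-\<^sup>c, (2 - c) / e)\<close>, at which the linear functional
  \<open>p\<^sub>1 - e\<^sup>c\<^sup>-\<^sup>1 p\<^sub>0\<close> is maximal. On a finite polytope each of these functionals would be maximal at one
  of finitely many vertices \<open>v\<close>. Differentiating in \<open>c\<close>, a vertex serving \<open>c\<close> has
  \<open>v\<^sub>0 = e\<^sup>-\<^sup>c\<close>, and there are infinitely many \<open>c\<close>.
\<close>

subsection \<open>Integration along the path measure\<close>

text \<open>The facts on step kernels and path measures that come with the definitions presuppose a Markov
  automaton and hence non-Zenoness. As non-Zenoness is itself a statement about path measures,
  they are first needed from positivity of the rates alone.\<close>

lemma prob_space_step_kernel_pos_rate:
  assumes "\<And>s. s \<in> markovian_states M \<Longrightarrow> 0 < exit_rate M s"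
  shows "prob_space (step_kernel M \<sigma> n \<omega>)"
proof (cases "state_at M \<omega> n \<in> markovian_states M")
  case True
  let ?E = "density lborel (exponential_density (exit_rate M (state_at M \<omega> n)))"
  let ?N = "measure_pmf (succ_dist M (state_at M \<omega> n) (bot_act M))"
  interpret pair_prob_space ?E ?N
    using prob_space_exponential_density[OF assms[OF True]]
    by (simp add: pair_prob_space_def pair_sigma_finite_def prob_space_imp_sigma_finite
        measure_pmf.prob_space_axioms)
  have "(\<lambda>(t, s'). (bot_act M, t, s')) \<in> ?E \<Otimes>\<^sub>M ?N \<rightarrow>\<^sub>M step_space"
    unfolding step_space_def
    by (subst measurable_cong_sets[OF sets_pair_measure_cong[OF sets_density sets_measure_pmf_count_space] refl])
      measurable
  with True show ?thesis
    unfolding step_kernel_def by (simp add: Let_def prob_space_distr)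
qed (auto intro!: measure_pmf.prob_space_distr
    simp: step_kernel_def Let_def step_space_def space_pair_measure)

lemma nn_integral_step_kernel_probabilistic:
  fixes M :: "('s, 'a) ma"
  assumes "state_at M \<omega> n \<notin> markovian_states M"
    and f: "f \<in> borel_measurable step_space"
  shows "(\<integral>\<^sup>+x. f x \<partial>step_kernel M \<sigma> n \<omega>) =
    (\<integral>\<^sup>+\<alpha>. \<integral>\<^sup>+s'. f (\<alpha>, 0, s') \<partial>succ_dist M (state_at M \<omega> n) \<alpha> \<partial>\<sigma> (map \<omega> [0..<n]))"
proof -
  have *: "(\<lambda>x. x) \<in> measure_pmf p \<rightarrow>\<^sub>M step_space" for p :: "('s, 'a) step pmf"
    by (simp add: step_space_def space_pair_measure)
  have "(\<integral>\<^sup>+x. f x \<partial>distr (measure_pmf p) step_space (\<lambda>x. x)) = (\<integral>\<^sup>+x. f x \<partial>p)" for p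
    by (subst nn_integral_distr[OF *]) (simp_all add: f)
  then show ?thesis
    using assms(1) by (simp add: step_kernel_def Let_def nn_integral_return_pmf)
qed

lemma measurable_step_kernel_pos_rate:
  fixes M :: "('s, nat) ma"
  assumes rate: "\<And>s. s \<in> markovian_states M \<Longrightarrow> 0 < exit_rate M s"
    and \<sigma>: "generic_scheduler M \<sigma>"
  shows "step_kernel M \<sigma> n \<in> PiM {0..<n} (\<lambda>_. step_space) \<rightarrow>\<^sub>M subprob_algebra step_space"
proof (rule measurable_subprob_algebra)
  fix \<omega> :: "nat \<Rightarrow> ('s, nat) step"
  show "subprob_space (step_kernel M \<sigma> n \<omega>)"
    using prob_space_step_kernel_pos_rate[OF rate] by (rule prob_space_imp_subprob_space)
  show "sets (step_kernel M \<sigma> n \<omega>) = sets step_space"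
    by (simp add: step_kernel_def Let_def)
next
  fix A :: "('s, nat) step set"
  assume A[measurable]: "A \<in> sets step_space"
  let ?P = "PiM {0..<n} (\<lambda>_. step_space :: ('s, nat) step measure)"
  let ?s = "\<lambda>\<omega>. state_at M \<omega> n"
  note [measurable] = measurable_state_at[OF order_refl, of M n]
  have [measurable]: "(\<lambda>\<omega>. pmf (\<sigma> (map \<omega> [0..<n])) \<alpha>) \<in> borel_measurable ?P" for \<alpha>
    using \<sigma> by (simp add: generic_scheduler_def)
  define f where "f s = emeasure (distr (density lborel (exponential_density (exit_rate M s)) \<Otimes>\<^sub>M
      measure_pmf (succ_dist M s (bot_act M))) step_space (\<lambda>(t, s'). (bot_act M, t, s'))) A" for s
  define g where "g \<alpha> s = (\<integral>\<^sup>+s'. indicator A (\<alpha>, 0, s') \<partial>succ_dist M s \<alpha>)" for \<alpha> s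
  have [measurable]: "(\<lambda>\<omega>. f (?s \<omega>)) \<in> borel_measurable ?P"
    by (rule measurable_compose[OF measurable_state_at[OF order_refl]]) simp
  have [measurable]: "(\<lambda>\<omega>. g \<alpha> (?s \<omega>)) \<in> borel_measurable ?P" for \<alpha>
    by (rule measurable_compose[OF measurable_state_at[OF order_refl]]) simp
  \<comment> \<open>The history enters through the current state, which is discrete, so that
    \<open>f\<close> and \<open>g\<close> are measurable in it for free, and through the action
    probabilities, which are measurable by the definition of a scheduler. As actions are natural
    numbers, the mixture over them is a series of measurable terms.\<close>
  have "emeasure (step_kernel M \<sigma> n \<omega>) A = (if ?s \<omega> \<in> markovian_states M then f (?s \<omega>)
      else suminf (\<lambda>\<alpha>. ennreal (pmf (\<sigma> (map \<omega> [0..<n])) \<alpha>) * g \<alpha> (?s \<omega>)))" for \<omega>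
  proof (cases "?s \<omega> \<in> markovian_states M")
    case False
    have "emeasure (step_kernel M \<sigma> n \<omega>) A = (\<integral>\<^sup>+x. indicator A x \<partial>step_kernel M \<sigma> n \<omega>)"
      using A by (intro nn_integral_indicator[symmetric]) (simp add: step_kernel_def Let_def)
    also have "\<dots> = suminf (\<lambda>\<alpha>. ennreal (pmf (\<sigma> (map \<omega> [0..<n])) \<alpha>) * g \<alpha> (?s \<omega>))"
      using False
      by (simp add: g_def nn_integral_step_kernel_probabilistic nn_integral_measure_pmf[of "\<sigma> _"]
          nn_integral_count_space_nat)
    finally show ?thesis using False by simp
  qed (simp add: f_def step_kernel_def Let_def)
  moreover have [measurable]: "Measurable.pred ?P (\<lambda>\<omega>. ?s \<omega> \<in> markovian_states M)"
    by (rule measurable_compose[OF measurable_state_at[OF order_refl]]) simp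
  moreover have "(\<lambda>\<omega>. suminf (\<lambda>\<alpha>. ennreal (pmf (\<sigma> (map \<omega> [0..<n])) \<alpha>) * g \<alpha> (?s \<omega>))) \<in> borel_measurable ?P"
    by measurable
  ultimately show "(\<lambda>\<omega>. emeasure (step_kernel M \<sigma> n \<omega>) A) \<in> borel_measurable ?P"
    by (simp only:) (intro measurable_If; measurable)
qed

text \<open>\<open>CI J\<close> is the law of the first \<open>up_to J\<close> steps projected to
  \<open>J\<close>; for an initial segment the projection discards nothing.\<close>

lemma (in Ionescu_Tulcea) CI_atLeast0LessThan: "CI {0..<n} = C 0 n (\<lambda>_. undefined)"
proof -
  have "up_to {0..<n} = n"
    using up_to_iff[of "{0..<n}" n] up_to_less[of "{0..<n}" "n - 1"] by (cases n) auto
  then show ?thesis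
    using distr_C[of n n "\<lambda>_. undefined" 0] by (simp add: CI_def)
qed

text \<open>\<open>C 0 (Suc n)\<close> binds \<open>C 0 n\<close> to \<open>eP n\<close>, which
  appends to a prefix one step drawn from \<open>P n\<close>; hence the last step can be integrated
  out first. The integrals over paths below are reduced to single kernels in this way.\<close>

lemma (in Ionescu_Tulcea) nn_integral_lim_Suc:
  assumes F[measurable]: "F \<in> borel_measurable (PiM {0..<Suc n} M)"
  shows "(\<integral>\<^sup>+\<omega>. F (restrict \<omega> {0..<Suc n}) \<partial>PF.lim) =
    (\<integral>\<^sup>+\<omega>. \<integral>\<^sup>+x. F (fun_upd (restrict \<omega> {0..<n}) n x) \<partial>P n (restrict \<omega> {0..<n}) \<partial>PF.lim)"
proof -
  have lim: "(\<integral>\<^sup>+\<omega>. G (restrict \<omega> {0..<k}) \<partial>PF.lim) = (\<integral>\<^sup>+\<omega>. G \<omega> \<partial>C 0 k (\<lambda>_. undefined))"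
    if "G \<in> borel_measurable (PiM {0..<k} M)" for k G
  proof -
    have "(\<lambda>\<omega>. restrict \<omega> {0..<k}) \<in> PF.lim \<rightarrow>\<^sub>M PiM {0..<k} M"
      by (subst measurable_cong_sets[OF PF.sets_lim refl]) (auto intro!: measurable_restrict)
    then show ?thesis
      using that by (simp add: CI_atLeast0LessThan[symmetric] distr_lim[symmetric] nn_integral_distr)
  qed
  have "(\<integral>\<^sup>+\<omega>. F (restrict \<omega> {0..<Suc n}) \<partial>PF.lim) = (\<integral>\<^sup>+\<omega>. \<integral>\<^sup>+\<omega>'. F \<omega>' \<partial>eP n \<omega> \<partial>C 0 n (\<lambda>_. undefined))"
    unfolding lim[OF F] C.simps add_0
  proof (rule nn_integral_bind[OF F])
    have "sets (C 0 n (\<lambda>_. undefined)) = sets (PiM {0..<n} M)"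
      using sets_C[of "\<lambda>_. undefined" 0 n] by (simp only: add_0 space_PiM) simp
    then show "eP n \<in> C 0 n (\<lambda>_. undefined) \<rightarrow>\<^sub>M subprob_algebra (PiM {0..<Suc n} M)"
      by (subst measurable_cong_sets[OF _ refl]) (auto intro: measurable_eP)
  qed
  also have "\<dots> = (\<integral>\<^sup>+\<omega>. \<integral>\<^sup>+\<omega>'. F \<omega>' \<partial>eP n (restrict \<omega> {0..<n}) \<partial>PF.lim)"
    by (intro lim[symmetric]) measurable
  also have "\<dots> = (\<integral>\<^sup>+\<omega>. \<integral>\<^sup>+x. F (fun_upd (restrict \<omega> {0..<n}) n x) \<partial>P n (restrict \<omega> {0..<n}) \<partial>PF.lim)"
    by (intro nn_integral_cong nn_integral_eP F) (auto simp: PF.space_lim space_PiM PiE_iff)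
  finally show ?thesis .
qed

lemma step_kernel_cong:
  assumes "\<And>i. i < n \<Longrightarrow> \<omega> i = \<omega>' i"
  shows "step_kernel M \<sigma> n \<omega> = step_kernel M \<sigma> n \<omega>'"
proof -
  have "map \<omega> [0..<n] = map \<omega>' [0..<n]" "state_at M \<omega> n = state_at M \<omega>' n"
    using assms by (auto simp: state_at_def split: nat.split)
  then show ?thesis unfolding step_kernel_def by (simp only:)
qed

locale positive_rates =
  fixes M :: "('s, nat) ma" and \<sigma> :: "('s, nat) step list \<Rightarrow> nat pmf"
  assumes rate: "\<And>s. s \<in> markovian_states M \<Longrightarrow> 0 < exit_rate M s"
    and scheduler: "generic_scheduler M \<sigma>"
begin

sublocale IT: Ionescu_Tulcea "step_kernel M \<sigma>" "\<lambda>_. step_space"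
  using measurable_step_kernel_pos_rate[OF rate scheduler] prob_space_step_kernel_pos_rate[OF rate]
  by (intro Ionescu_Tulcea.intro)

lemma sets_path: "sets (path_measure M \<sigma>) = sets (PiM UNIV (\<lambda>_. step_space))"
  by (simp add: path_measure_def)

lemma prob_space_path: "prob_space (path_measure M \<sigma>)"
proof (rule prob_space_distrD)
  show "(\<lambda>\<omega>. restrict \<omega> {}) \<in> path_measure M \<sigma> \<rightarrow>\<^sub>M PiM {} (\<lambda>_. step_space)"
    by (subst measurable_cong_sets[OF sets_path refl]) (auto intro!: measurable_restrict)
  show "prob_space (distr (path_measure M \<sigma>) (PiM {} (\<lambda>_. step_space)) (\<lambda>\<omega>. restrict \<omega> {}))"
    using IT.PF.prob_space_P[of "{}"] by (simp add: path_measure_def IT.distr_lim)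
qed

text \<open>The disintegration of the last step for functions of whole paths, so that applications
  are free of restrictions to prefixes.\<close>

lemma nn_integral_path_measure_Suc:
  assumes F: "F \<in> borel_measurable (PiM UNIV (\<lambda>_. step_space))"
    and local: "\<And>\<omega> \<omega>'. (\<And>i. i \<le> n \<Longrightarrow> \<omega> i = \<omega>' i) \<Longrightarrow> F \<omega> = F \<omega>'"
  shows "(\<integral>\<^sup>+\<omega>. F \<omega> \<partial>path_measure M \<sigma>) =
    (\<integral>\<^sup>+\<omega>. \<integral>\<^sup>+x. F (fun_upd \<omega> n x) \<partial>step_kernel M \<sigma> n \<omega> \<partial>path_measure M \<sigma>)"
proof -
  \<comment> \<open>Padding with \<open>undefined\<close> maps prefixes measurably into the path
    space, and by \<open>local\<close> the padding does not affect \<open>F\<close>. So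
    \<open>F\<close> is measurable on prefixes.\<close>
  have "(\<lambda>\<omega> i. if i \<in> {0..<Suc n} then \<omega> i else undefined) \<in>
      PiM {0..<Suc n} (\<lambda>_. step_space) \<rightarrow>\<^sub>M PiM UNIV (\<lambda>_. step_space :: ('s, nat) step measure)"
  proof (rule measurable_PiM_single')
    show "(\<lambda>\<omega>. if i \<in> {0..<Suc n} then \<omega> i else undefined) \<in>
        PiM {0..<Suc n} (\<lambda>_. step_space) \<rightarrow>\<^sub>M (step_space :: ('s, nat) step measure)" for i
      by (cases "i \<in> {0..<Suc n}") (auto simp: step_space_def space_pair_measure)
  qed (auto simp: step_space_def space_pair_measure)
  from measurable_compose[OF this F]
  have "F \<in> borel_measurable (PiM {0..<Suc n} (\<lambda>_. step_space))"
    by (rule measurable_cong[THEN iffD1, rotated]) (auto intro!: local)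
  from IT.nn_integral_lim_Suc[OF this]
  have "(\<integral>\<^sup>+\<omega>. F (restrict \<omega> {0..<Suc n}) \<partial>path_measure M \<sigma>) =
    (\<integral>\<^sup>+\<omega>. \<integral>\<^sup>+x. F (fun_upd (restrict \<omega> {0..<n}) n x) \<partial>step_kernel M \<sigma> n (restrict \<omega> {0..<n}) \<partial>path_measure M \<sigma>)"
    by (simp only: path_measure_def)
  moreover have "F (restrict \<omega> {0..<Suc n}) = F \<omega>" for \<omega>
    by (rule local) simp
  moreover have "F (fun_upd (restrict \<omega> {0..<n}) n x) = F (fun_upd \<omega> n x)" for \<omega> x
    by (rule local) simp
  moreover have "step_kernel M \<sigma> n (restrict \<omega> {0..<n}) = step_kernel M \<sigma> n \<omega>" for \<omega>
    by (rule step_kernel_cong) simp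
  ultimately show ?thesis by (simp only:)
qed

text \<open>As the kernel has to avoid the complement of \<open>A\<close> only after almost every
  history, almost sure properties of paths can be proved by induction on the steps.\<close>

lemma AE_path_measure_step:
  assumes A[measurable]: "A \<in> sets step_space"
    and null: "AE \<omega> in path_measure M \<sigma>. (\<integral>\<^sup>+x. indicator (- A) x \<partial>step_kernel M \<sigma> n \<omega>) = 0"
  shows "AE \<omega> in path_measure M \<sigma>. \<omega> n \<in> A"
proof -
  note [measurable_cong] = sets_path
  have "(\<integral>\<^sup>+\<omega>. indicator (- A) (\<omega> n) \<partial>path_measure M \<sigma>) =
      (\<integral>\<^sup>+\<omega>. \<integral>\<^sup>+x. indicator (- A) x \<partial>step_kernel M \<sigma> n \<omega> \<partial>path_measure M \<sigma>)"
    by (subst nn_integral_path_measure_Suc[where n=n]) simp_all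
  also have "\<dots> = (\<integral>\<^sup>+\<omega>. 0 \<partial>path_measure M \<sigma>)"
    by (rule nn_integral_cong_AE) fact
  finally have "AE \<omega> in path_measure M \<sigma>. indicator (- A) (\<omega> n) = (0 :: ennreal)"
    by (simp add: nn_integral_0_iff_AE)
  then show ?thesis by eventually_elim (simp add: indicator_def split: if_splits)
qed

lemma measurable_scheduler:
  "(\<lambda>\<omega>. pmf (\<sigma> (map \<omega> [0..<n])) \<alpha>) \<in> borel_measurable (PiM UNIV (\<lambda>_. step_space))"
proof -
  have "(\<lambda>\<omega>. pmf (\<sigma> (map (restrict \<omega> {0..<n}) [0..<n])) \<alpha>) \<in> borel_measurable (PiM UNIV (\<lambda>_. step_space))"
    using scheduler
    by (intro measurable_compose[OF measurable_restrict_subset]) (auto simp: generic_scheduler_def)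
  moreover have "map (restrict \<omega> {0..<n}) [0..<n] = map \<omega> [0..<n]" for \<omega> :: "nat \<Rightarrow> ('s, nat) step"
    by simp
  ultimately show ?thesis by (simp only:)
qed

end

subsection \<open>The unit exponential distribution\<close>

abbreviation exp_dist :: "real measure" where
  "exp_dist \<equiv> density lborel (exponential_density 1)"

lemma prob_space_exp_dist: "prob_space exp_dist"
  by (simp add: prob_space_exponential_density)

lemma AE_exp_dist_nonneg: "AE t in exp_dist. 0 \<le> t"
  by (subst AE_density) (auto simp: exponential_density_def)

text \<open>The truncation at 0 allows \<open>u\<close> to be the time remaining until a deadline,
  which is negative once the deadline has passed.\<close>

lemma emeasure_exp_dist_atLeast: "emeasure exp_dist {u..} = ennreal (exp (- max 0 u))"
proof -
  interpret prob_space exp_dist by (rule prob_space_exp_dist)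
  have *: "emeasure exp_dist {u..} = ennreal (exp (- u))" if "0 \<le> u" for u
  proof -
    have "distributed exp_dist lborel (\<lambda>t. t) (exponential_density 1)"
      by (auto simp: distributed_def emeasure_distr intro!: measure_eqI)
    from exponential_distributedD_gt[OF this that]
    have "prob {u<..} = exp (- u)" by (simp add: greaterThan_def)
    moreover have "AE t in exp_dist. t \<in> {u..} \<longleftrightarrow> t \<in> {u<..}"
      using AE_lborel_singleton[of u] by (subst AE_density) (auto elim: eventually_mono)
    then have "prob {u..} = prob {u<..}"
      by (intro finite_measure_eq_AE) auto
    ultimately show ?thesis by (simp add: emeasure_eq_measure)
  qed
  show ?thesis
  proof (cases "0 \<le> u")
    case False
    have "emeasure exp_dist {u..} = emeasure exp_dist {0..}"
      using AE_exp_dist_nonneg False by (intro emeasure_eq_AE) (auto elim: eventually_mono)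
    then show ?thesis using False *[of 0] by simp
  qed (simp add: * max_absorb2)
qed

text \<open>On the support the integrand \<open>exp (- t) * exp (- t)\<close> is half the density of
  the exponential distribution with rate 2.\<close>

lemma nn_integral_exp_dist_exp: "(\<integral>\<^sup>+t. ennreal (exp (- t)) \<partial>exp_dist) = ennreal (1 / 2)"
proof -
  interpret E2: prob_space "density lborel (exponential_density 2)"
    by (simp add: prob_space_exponential_density)
  have "(\<integral>\<^sup>+t. ennreal (exp (- t)) \<partial>exp_dist) =
      (\<integral>\<^sup>+t. ennreal (exponential_density 1 t) * ennreal (exp (- t)) \<partial>lborel)"
    by (subst nn_integral_density) auto
  also have "\<dots> = (\<integral>\<^sup>+t. ennreal (1 / 2) * ennreal (exponential_density 2 t) \<partial>lborel)"
  proof (intro nn_integral_cong)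
    fix t
    have "exponential_density 1 t * exp (- t) = 1 / 2 * exponential_density 2 t"
      by (simp add: exponential_density_def flip: exp_add)
    then show "ennreal (exponential_density 1 t) * ennreal (exp (- t)) =
        ennreal (1 / 2) * ennreal (exponential_density 2 t)"
      by (metis ennreal_mult exp_ge_zero exponential_density_nonneg zero_le_divide_1_iff zero_le_numeral
          zero_less_numeral zero_less_one)
  qed
  also have "\<dots> = ennreal (1 / 2) * (\<integral>\<^sup>+t. ennreal (exponential_density 2 t) \<partial>lborel)"
    by (rule nn_integral_cmult) simp
  also have "(\<integral>\<^sup>+t. ennreal (exponential_density 2 t) \<partial>lborel) = 1"
    using E2.emeasure_space_1 by (simp add: emeasure_density)
  finally show ?thesis by simp
qed

subsection \<open>The automaton\<close>

lemma measurable_step_components [measurable]: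
  "(\<lambda>x. fst (snd x)) \<in> borel_measurable step_space"
  "(\<lambda>x. snd (snd x)) \<in> step_space \<rightarrow>\<^sub>M count_space UNIV"
  unfolding step_space_def by measurable

lemma measurable_time_at [measurable]:
  "(\<lambda>\<omega>. time_at \<omega> n) \<in> borel_measurable (PiM UNIV (\<lambda>_. step_space))"
  unfolding time_at_def by measurable

text \<open>State 0 is the clock and state 1 the decision: action 1 goes to the sink 2, action 2 to
  the goal state 3, which is later left for the sink. The self-loop of the sink is there because
  every state needs an outgoing transition; action 0 is \<bottom>.\<close>

definition fork_ma :: "(nat, nat) ma" where
  "fork_ma = \<lparr>states = {0, 1, 2, 3}, acts = {0, 1, 2}, bot_act = 0,
    transitions = {(0, Inr 1, return_pmf 1), (1, Inl 1, return_pmf 2), (1, Inl 2, return_pmf 3),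
      (2, Inr 1, return_pmf 2), (3, Inr 1, return_pmf 2)},
    init = 0, rewards = []\<rparr>"

lemma fork_ma_simps [simp]:
  "init fork_ma = 0" "bot_act fork_ma = 0"
  "markovian_states fork_ma = {0, 2, 3}" "probabilistic_states fork_ma = {1}"
  by (auto simp: fork_ma_def markovian_states_def probabilistic_states_def)

lemma moves_fork_ma:
  "moves fork_ma s \<alpha> \<mu> \<longleftrightarrow> (s, \<alpha>, \<mu>) \<in> {(0, 0, return_pmf 1), (1, 1, return_pmf 2),
    (1, 2, return_pmf 3), (2, 0, return_pmf 2), (3, 0, return_pmf 2)}"
  by (auto simp: fork_ma_def moves_def)

lemma exit_rate_fork_ma: "s \<in> {0, 2, 3} \<Longrightarrow> exit_rate fork_ma s = 1"
  unfolding exit_rate_def by (rule the_equality) (auto simp: fork_ma_def)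

lemma enabled_fork_ma: "enabled fork_ma s = (if s \<in> {0, 2, 3} then {0} else if s = 1 then {1, 2} else {})"
  by (auto simp: enabled_def moves_fork_ma)

lemma succ_dist_fork_ma:
  "succ_dist fork_ma 0 0 = return_pmf 1" "succ_dist fork_ma 2 0 = return_pmf 2"
  "succ_dist fork_ma 3 0 = return_pmf 2" "succ_dist fork_ma 1 1 = return_pmf 2"
  "succ_dist fork_ma 1 2 = return_pmf 3"
  by (auto simp: succ_dist_def moves_fork_ma)

text \<open>The possible values of the \<open>n\<close>-th step of a path.\<close>

definition fork_steps :: "nat \<Rightarrow> (nat, nat) step set" where
  "fork_steps n =
    (if n = 0 then {0} \<times> {0..} \<times> {1}
     else if n = 1 then {1} \<times> {0} \<times> {2} \<union> {2} \<times> {0} \<times> {3}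
     else {0} \<times> {0..} \<times> {2})"

lemma sets_fork_steps [measurable]: "fork_steps n \<in> sets step_space"
  unfolding fork_steps_def step_space_def by (simp only: split: if_split)
    (intro conjI impI sets.Un pair_measureI; simp)

text \<open>All rates are 1 and all successor distributions are Dirac, so the sojourn time is the
  only random component of the step.\<close>

lemma nn_integral_step_kernel_fork_markovian:
  assumes s: "state_at fork_ma \<omega> n \<in> {0, 2, 3}" and f: "f \<in> borel_measurable step_space"
  shows "(\<integral>\<^sup>+x. f x \<partial>step_kernel fork_ma \<sigma> n \<omega>) =
    (\<integral>\<^sup>+t. f (0, t, if state_at fork_ma \<omega> n = 0 then 1 else 2) \<partial>exp_dist)"
proof -
  define s' :: nat where "s' = (if state_at fork_ma \<omega> n = 0 then 1 else 2)"
  have succ: "succ_dist fork_ma (state_at fork_ma \<omega> n) 0 = return_pmf s'"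
    using s by (auto simp: s'_def succ_dist_fork_ma)
  have meas: "(\<lambda>(t, s). (0, t, s)) \<in> exp_dist \<Otimes>\<^sub>M return_pmf s' \<rightarrow>\<^sub>M step_space"
    unfolding step_space_def
    by (subst measurable_cong_sets[OF sets_pair_measure_cong[OF sets_density sets_measure_pmf_count_space] refl])
      measurable
  have "(\<integral>\<^sup>+x. f x \<partial>step_kernel fork_ma \<sigma> n \<omega>) =
      (\<integral>\<^sup>+x. f x \<partial>distr (exp_dist \<Otimes>\<^sub>M return_pmf s') step_space (\<lambda>(t, s). (0, t, s)))"
    using s by (simp add: step_kernel_def Let_def exit_rate_fork_ma succ)
  also have "\<dots> = (\<integral>\<^sup>+x. f (case x of (t, s) \<Rightarrow> (0, t, s)) \<partial>(exp_dist \<Otimes>\<^sub>M return_pmf s'))"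
    by (subst nn_integral_distr[OF meas]) (simp_all add: f)
  also have "\<dots> = (\<integral>\<^sup>+t. \<integral>\<^sup>+s. f (0, t, s) \<partial>return_pmf s' \<partial>exp_dist)"
    using measure_pmf.nn_integral_fst[of "\<lambda>x. f (case x of (t, s) \<Rightarrow> (0, t, s))" exp_dist "return_pmf s'"]
      measurable_compose[OF meas f] by simp
  finally show ?thesis by (simp add: nn_integral_return_pmf s'_def)
qed

text \<open>The support of the scheduler is a hypothesis because \<open>generic_scheduler\<close>
  restricts it on genuine paths only.\<close>

lemma nn_integral_step_kernel_fork_probabilistic:
  assumes "state_at fork_ma \<omega> n = 1" and "set_pmf (\<sigma> (map \<omega> [0..<n])) \<subseteq> {1, 2}"
    and "f \<in> borel_measurable step_space"
  shows "(\<integral>\<^sup>+x. f x \<partial>step_kernel fork_ma \<sigma> n \<omega>) =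
    f (1, 0, 2) * pmf (\<sigma> (map \<omega> [0..<n])) 1 + f (2, 0, 3) * pmf (\<sigma> (map \<omega> [0..<n])) 2"
proof -
  have "(\<integral>\<^sup>+x. f x \<partial>step_kernel fork_ma \<sigma> n \<omega>) =
      (\<integral>\<^sup>+\<alpha>. \<integral>\<^sup>+s'. f (\<alpha>, 0, s') \<partial>succ_dist fork_ma 1 \<alpha> \<partial>\<sigma> (map \<omega> [0..<n]))"
    using assms by (simp add: nn_integral_step_kernel_probabilistic)
  also have "\<dots> = (\<Sum>\<alpha>\<in>{1, 2}. (\<integral>\<^sup>+s'. f (\<alpha>, 0, s') \<partial>succ_dist fork_ma 1 \<alpha>) * pmf (\<sigma> (map \<omega> [0..<n])) \<alpha>)"
    using assms(2) by (intro nn_integral_measure_pmf_support) auto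
  finally show ?thesis
    by (simp add: succ_dist_fork_ma nn_integral_return_pmf del: One_nat_def)
qed

section \<open>Almost sure shape of the paths, and non-Zenoness\<close>

locale scheduled_fork =
  fixes \<sigma> :: "(nat, nat) step list \<Rightarrow> nat pmf"
  assumes scheduler_fork: "generic_scheduler fork_ma \<sigma>"
begin

sublocale positive_rates fork_ma \<sigma>
  by standard (auto simp: exit_rate_fork_ma scheduler_fork)

sublocale prob_space "path_measure fork_ma \<sigma>"
  by (rule prob_space_path)

declare sets_path [measurable_cong]

text \<open>A possible first step forms a path that ends in state 1, where exactly the actions 1 and
  2 are enabled.\<close>

lemma set_pmf_scheduler:
  assumes "\<omega> 0 \<in> fork_steps 0"
  shows "set_pmf (\<sigma> (map \<omega> [0..<1])) \<subseteq> {1, 2}"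
proof -
  from assms obtain t where "\<omega> 0 = (0, t, 1)" "0 \<le> t" by (auto simp: fork_steps_def)
  then have "path_from fork_ma (init fork_ma) (map \<omega> [0..<1])"
    "last_state fork_ma (map \<omega> [0..<1]) = 1"
    by (simp_all add: enabled_fork_ma succ_dist_fork_ma last_state_def)
  then show ?thesis
    using scheduler_fork unfolding generic_scheduler_def
    by (metis enabled_fork_ma insert_iff empty_iff one_neq_zero numeral_eq_one_iff num.distinct(1,3))
qed

text \<open>Induction with \<open>AE_path_measure_step\<close>: membership of step \<open>n\<close>
  in \<open>fork_steps n\<close> determines which kernel produces the next step, and for
  \<open>n = 0\<close> it also makes the scheduler choose an enabled action.\<close>

lemma AE_fork_steps: "AE \<omega> in path_measure fork_ma \<sigma>. \<forall>n. \<omega> n \<in> fork_steps n"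
proof -
  have nonneg: "(\<integral>\<^sup>+t. indicator (- ({0::nat} \<times> {0..} \<times> {s})) (0, t, s) \<partial>exp_dist) = 0" for s :: nat
  proof -
    have "(\<integral>\<^sup>+t. indicator (- ({0::nat} \<times> {0..} \<times> {s})) (0, t, s) \<partial>exp_dist) = (\<integral>\<^sup>+t. 0 \<partial>exp_dist)"
      using AE_exp_dist_nonneg by (intro nn_integral_cong_AE) (auto elim!: eventually_mono)
    then show ?thesis by simp
  qed
  have meas: "indicator (- fork_steps n) \<in> borel_measurable step_space" for n
    by measurable
  have "AE \<omega> in path_measure fork_ma \<sigma>. \<omega> n \<in> fork_steps n" for n
  proof (induction n)
    case 0
    show ?case
      using nonneg[of 1]
      by (intro AE_path_measure_step[OF sets_fork_steps] AE_I2,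
          subst nn_integral_step_kernel_fork_markovian[OF _ meas])
        (simp_all add: state_at_def fork_steps_def)
  next
    case (Suc n)
    show ?case
    proof (rule AE_path_measure_step[OF sets_fork_steps], use Suc in eventually_elim)
      fix \<omega> assume \<omega>: "\<omega> n \<in> fork_steps n"
      show "(\<integral>\<^sup>+x. indicator (- fork_steps (Suc n)) x \<partial>step_kernel fork_ma \<sigma> (Suc n) \<omega>) = 0"
      proof (cases "n = 0")
        case True
        with \<omega> have "state_at fork_ma \<omega> (Suc n) = 1" by (auto simp: state_at_def fork_steps_def)
        then show ?thesis
          using \<omega> set_pmf_scheduler[of \<omega>] True
          by (subst nn_integral_step_kernel_fork_probabilistic[OF _ _ meas]) (simp_all add: fork_steps_def)
      next
        case False
        with \<omega> have "state_at fork_ma \<omega> (Suc n) \<in> {2, 3}"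
          by (auto simp: state_at_def fork_steps_def split: if_splits)
        then show ?thesis
          using False
          by (subst nn_integral_step_kernel_fork_markovian[OF _ meas]) (auto simp: nonneg fork_steps_def)
      qed
    qed
  qed
  then show ?thesis by (simp add: AE_all_countable)
qed

text \<open>Non-Zenoness: as \<open>\<integral> e\<^sup>-\<^sup>t e\<^sup>-\<^sup>t dt = 1/2\<close>, the expectation of \<open>exp (- time_at \<omega> n)\<close> decays
  geometrically, so these numbers are almost surely summable.\<close>

lemma nn_integral_exp_time_Suc:
  assumes "n \<noteq> 1"
  shows "(\<integral>\<^sup>+\<omega>. ennreal (exp (- time_at \<omega> (Suc n))) \<partial>path_measure fork_ma \<sigma>) =
    ennreal (1 / 2) * (\<integral>\<^sup>+\<omega>. ennreal (exp (- time_at \<omega> n)) \<partial>path_measure fork_ma \<sigma>)"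
proof -
  have upd: "time_at (fun_upd \<omega> n x) (Suc n) = time_at \<omega> n + fst (snd x)"
    for \<omega> :: "nat \<Rightarrow> (nat, nat) step" and x
    by (simp add: time_at_def)
  have "(\<integral>\<^sup>+\<omega>. ennreal (exp (- time_at \<omega> (Suc n))) \<partial>path_measure fork_ma \<sigma>) =
      (\<integral>\<^sup>+\<omega>. \<integral>\<^sup>+x. ennreal (exp (- time_at \<omega> n)) * ennreal (exp (- fst (snd x)))
        \<partial>step_kernel fork_ma \<sigma> n \<omega> \<partial>path_measure fork_ma \<sigma>)"
    by (subst nn_integral_path_measure_Suc[where n=n])
      (auto simp: upd ennreal_mult[symmetric] exp_add[symmetric] exp_diff[symmetric] time_at_def)
  also have "\<dots> = (\<integral>\<^sup>+\<omega>. ennreal (1 / 2) * ennreal (exp (- time_at \<omega> n)) \<partial>path_measure fork_ma \<sigma>)"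
  proof (rule nn_integral_cong_AE, use AE_fork_steps in eventually_elim)
    fix \<omega> :: "nat \<Rightarrow> (nat, nat) step" assume "\<forall>n. \<omega> n \<in> fork_steps n"
    \<comment> \<open>For positive \<open>n\<close> the state at position \<open>n\<close> is
      recorded in step \<open>n - 1\<close>; position 0 holds the initial state. Only position 1 is
      probabilistic, and there no time passes, so it is excluded by assumption.\<close>
    then have "\<omega> (n - 1) \<in> fork_steps (n - 1)" by blast
    then have "state_at fork_ma \<omega> n \<in> {0, 2, 3}"
      using assms by (cases n) (auto simp: state_at_def fork_steps_def split: if_splits)
    moreover have "(\<integral>\<^sup>+t. ennreal (exp (- time_at \<omega> n)) * ennreal (exp (- t)) \<partial>exp_dist) =
        ennreal (1 / 2) * ennreal (exp (- time_at \<omega> n))"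
      by (subst nn_integral_cmult) (simp_all add: nn_integral_exp_dist_exp mult.commute)
    ultimately show "(\<integral>\<^sup>+x. ennreal (exp (- time_at \<omega> n)) * ennreal (exp (- fst (snd x))) \<partial>step_kernel fork_ma \<sigma> n \<omega>)
        = ennreal (1 / 2) * ennreal (exp (- time_at \<omega> n))"
      by (subst nn_integral_step_kernel_fork_markovian)
        simp_all
  qed
  also have "\<dots> = ennreal (1 / 2) * (\<integral>\<^sup>+\<omega>. ennreal (exp (- time_at \<omega> n)) \<partial>path_measure fork_ma \<sigma>)"
    by (rule nn_integral_cmult) measurable
  finally show ?thesis .
qed

text \<open>The count starts at two because the decision at position 1 contributes no factor 1/2.
  The base case needs only that the elapsed time is nonnegative.\<close>

lemma nn_integral_exp_time_le:
  "(\<integral>\<^sup>+\<omega>. ennreal (exp (- time_at \<omega> (Suc (Suc n)))) \<partial>path_measure fork_ma \<sigma>) \<le> ennreal ((1 / 2) ^ n)"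
proof (induction n)
  case 0
  have "(\<integral>\<^sup>+\<omega>. ennreal (exp (- time_at \<omega> (Suc (Suc 0)))) \<partial>path_measure fork_ma \<sigma>) \<le>
      (\<integral>\<^sup>+\<omega>. 1 \<partial>path_measure fork_ma \<sigma>)"
  proof (rule nn_integral_mono_AE, use AE_fork_steps in eventually_elim)
    fix \<omega> :: "nat \<Rightarrow> (nat, nat) step" assume "\<forall>n. \<omega> n \<in> fork_steps n"
    then have "\<omega> 0 \<in> fork_steps 0" "\<omega> 1 \<in> fork_steps 1" by blast+
    then have "0 \<le> time_at \<omega> (Suc (Suc 0))" by (auto simp: time_at_def fork_steps_def)
    then show "ennreal (exp (- time_at \<omega> (Suc (Suc 0)))) \<le> 1" by (simp add: ennreal_le_1)
  qed
  then show ?case by (simp add: emeasure_space_1)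
next
  case (Suc n)
  have "ennreal (1 / 2) * (\<integral>\<^sup>+\<omega>. ennreal (exp (- time_at \<omega> (Suc (Suc n)))) \<partial>path_measure fork_ma \<sigma>) \<le>
      ennreal (1 / 2) * ennreal ((1 / 2) ^ n)"
    by (rule mult_left_mono[OF Suc]) simp
  also have "\<dots> = ennreal ((1 / 2) ^ Suc n)"
    by (subst ennreal_mult[symmetric]) simp_all
  finally show ?case
    using nn_integral_exp_time_Suc[of "Suc (Suc n)"] by simp
qed

lemma AE_time_diverges: "AE \<omega> in path_measure fork_ma \<sigma>. filterlim (time_at \<omega>) at_top sequentially"
proof -
  have "(\<integral>\<^sup>+\<omega>. suminf (\<lambda>n. ennreal (exp (- time_at \<omega> (Suc (Suc n))))) \<partial>path_measure fork_ma \<sigma>) \<le>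
      suminf (\<lambda>n. ennreal ((1 / 2) ^ n))"
    by (subst nn_integral_suminf) (auto intro!: suminf_le nn_integral_exp_time_le)
  also have "\<dots> < \<infinity>"
    using summable_geometric[of "1 / 2 :: real"] by (subst suminf_ennreal2) auto
  finally have "AE \<omega> in path_measure fork_ma \<sigma>. suminf (\<lambda>n. ennreal (exp (- time_at \<omega> (Suc (Suc n))))) \<noteq> \<infinity>"
    by (intro nn_integral_PInf_AE) auto
  then show ?thesis
  proof eventually_elim
    fix \<omega> :: "nat \<Rightarrow> (nat, nat) step"
    assume "suminf (\<lambda>n. ennreal (exp (- time_at \<omega> (Suc (Suc n))))) \<noteq> \<infinity>"
    then have "summable (\<lambda>n. exp (- time_at \<omega> (Suc (Suc n))))"
      by (intro summable_suminf_not_top) auto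
    then have "(\<lambda>n. exp (- time_at \<omega> (Suc (Suc n)))) \<longlonglongrightarrow> 0"
      by (rule summable_LIMSEQ_zero)
    then have "(\<lambda>n. exp (- time_at \<omega> n)) \<longlonglongrightarrow> 0"
      using LIMSEQ_offset[of "\<lambda>n. exp (- time_at \<omega> n)" 2] by simp
    then have "filterlim (\<lambda>n. inverse (exp (- time_at \<omega> n))) at_top sequentially"
      by (intro filterlim_inverse_at_top) auto
    then have "filterlim (\<lambda>n. ln (exp (time_at \<omega> n))) at_top sequentially"
      by (intro filterlim_compose[OF ln_at_top]) (simp add: exp_minus)
    then show "filterlim (time_at \<omega>) at_top sequentially" by simp
  qed
qed

end

lemma markov_automaton_fork_ma: "markov_automaton fork_ma"
proof -
  have "AE \<omega> in path_measure fork_ma \<sigma>. filterlim (time_at \<omega>) at_top sequentially"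
    if "generic_scheduler fork_ma \<sigma>" for \<sigma>
  proof -
    interpret scheduled_fork \<sigma> by standard fact
    show ?thesis by (rule AE_time_diverges)
  qed
  then show ?thesis
    unfolding markov_automaton_def by (simp, auto simp: fork_ma_def)
qed

section \<open>Values of the reachability objectives under a scheduler\<close>

context scheduled_fork
begin

abbreviation choice_prob :: "real \<Rightarrow> real" where
  "choice_prob t \<equiv> pmf (\<sigma> [(0, t, 1)]) 2"

lemma measurable_choice_prob [measurable]: "choice_prob \<in> borel_measurable borel"
proof -
  \<comment> \<open>A constant path serves as carrier of the clock value: for \<open>n = 1\<close>
    the scheduler reads coordinate 0 only.\<close>
  have "(\<lambda>t _. (0, t, 1)) \<in> borel \<rightarrow>\<^sub>M PiM UNIV (\<lambda>_. step_space :: (nat, nat) step measure)"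
    by (rule measurable_PiM_single') (auto simp: step_space_def space_pair_measure)
  from measurable_compose[OF this measurable_scheduler[of 1 2]] show ?thesis by simp
qed

text \<open>In the proof, \<open>F\<close> and \<open>G\<close> arise from the event \<open>hit\<close> by integrating out the third and then
  the second step.\<close>

lemma reach_value_fork:
  assumes "0 \<le> a"
  shows "reach_value fork_ma \<sigma> ({a..}, {3}) = (\<integral>t. choice_prob t * exp (- max 0 (a - t)) \<partial>exp_dist)"
proof -
  define hit where "hit \<omega> \<longleftrightarrow> snd (snd (\<omega> 1)) = 3 \<and> a \<le> time_at \<omega> (Suc 2)"
    for \<omega> :: "nat \<Rightarrow> (nat, nat) step"
  define F where "F \<omega> = indicator {\<omega>. snd (snd (\<omega> 1)) = 3} \<omega> * ennreal (exp (- max 0 (a - time_at \<omega> (Suc 1))))"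
    for \<omega> :: "nat \<Rightarrow> (nat, nat) step"
  define G where "G \<omega> = ennreal (pmf (\<sigma> (map \<omega> [0..<1])) 2) * ennreal (exp (- max 0 (a - time_at \<omega> (Suc 0))))"
    for \<omega> :: "nat \<Rightarrow> (nat, nat) step"
  let ?P = "path_measure fork_ma \<sigma>"
  let ?\<Omega> = "PiM UNIV (\<lambda>_. step_space :: (nat, nat) step measure)"
  have [simp]: "space ?\<Omega> = UNIV"
    by (simp add: space_PiM step_space_def space_pair_measure)
  note [measurable] = measurable_scheduler
  have [measurable]: "Measurable.pred ?\<Omega> hit"
    unfolding hit_def by measurable
  have [measurable]: "{\<omega>. snd (snd (\<omega> 1)) = 3} \<in> sets ?\<Omega>"
  proof -
    have "{\<omega> \<in> space ?\<Omega>. snd (snd (\<omega> 1)) = 3} \<in> sets ?\<Omega>" by measurable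
    then show ?thesis by simp
  qed
  have time_cong: "time_at \<omega> k = time_at \<omega>' k" if "\<And>i. i < k \<Longrightarrow> \<omega> i = \<omega>' i"
    for \<omega> \<omega>' :: "nat \<Rightarrow> (nat, nat) step" and k
    using that by (simp add: time_at_def)
  have time_upd: "time_at (fun_upd \<omega> k x) (Suc k) = time_at \<omega> k + fst (snd x)"
    for \<omega> :: "nat \<Rightarrow> (nat, nat) step" and k x
    by (simp add: time_at_def)

  have "emeasure ?P (reach_paths fork_ma {a..} {3}) = emeasure ?P {\<omega>. hit \<omega>}"
  proof (rule emeasure_eq_AE, use AE_fork_steps in eventually_elim)
    fix \<omega> :: "nat \<Rightarrow> (nat, nat) step" assume \<omega>: "\<forall>n. \<omega> n \<in> fork_steps n"
    \<comment> \<open>State 3 can be occupied at position 2 only, that is, from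
      \<open>time_at \<omega> 2\<close> to \<open>time_at \<omega> (Suc 2)\<close>. This interval
      meets \<open>{a..}\<close> iff its right end is at least \<open>a\<close>, which is what
      \<open>hit\<close> says.\<close>
    have "state_at fork_ma \<omega> n = 3 \<longleftrightarrow> n = 2 \<and> snd (snd (\<omega> 1)) = 3" for n
    proof (cases n)
      case (Suc m)
      then show ?thesis
        using \<omega>[rule_format, of m] by (cases "m = 1") (auto simp: state_at_def fork_steps_def split: if_splits)
    qed (simp add: state_at_def)
    moreover have "time_at \<omega> 2 \<le> time_at \<omega> (Suc 2)"
      using \<omega>[rule_format, of 2] unfolding time_at_def sum.lessThan_Suc by (auto simp: fork_steps_def)
    ultimately show "\<omega> \<in> reach_paths fork_ma {a..} {3} \<longleftrightarrow> \<omega> \<in> {\<omega>. hit \<omega>}"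
      by (auto simp: reach_paths_def hit_def)
  next
    have "reach_objective fork_ma ({a..}, {3})"
      using assms by (auto simp: reach_objective_def fork_ma_def)
    then show "reach_paths fork_ma {a..} {3} \<in> sets ?P"
      using sets_reach_paths by (simp add: sets_path)
    have "{\<omega> \<in> space ?\<Omega>. hit \<omega>} \<in> sets ?\<Omega>" by measurable
    then show "{\<omega>. hit \<omega>} \<in> sets ?P" by (simp add: sets_path)
  qed
  also have "\<dots> = (\<integral>\<^sup>+\<omega>. indicator {\<omega>. hit \<omega>} \<omega> \<partial>?P)"
  proof (rule nn_integral_indicator[symmetric])
    have "{\<omega> \<in> space ?\<Omega>. hit \<omega>} \<in> sets ?\<Omega>" by measurable
    then show "{\<omega>. hit \<omega>} \<in> sets ?P" by (simp add: sets_path)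
  qed
  also have "\<dots> = (\<integral>\<^sup>+\<omega>. \<integral>\<^sup>+x. indicator {\<omega>. hit \<omega>} (fun_upd \<omega> 2 x) \<partial>step_kernel fork_ma \<sigma> 2 \<omega> \<partial>?P)"
  proof (rule nn_integral_path_measure_Suc)
    fix \<omega> \<omega>' :: "nat \<Rightarrow> (nat, nat) step" assume "\<And>i. i \<le> 2 \<Longrightarrow> \<omega> i = \<omega>' i"
    then show "indicator {\<omega>. hit \<omega>} \<omega> = (indicator {\<omega>. hit \<omega>} \<omega>' :: ennreal)"
      using time_cong[of "Suc 2" \<omega> \<omega>'] by (simp add: hit_def indicator_def less_Suc_eq_le)
  qed (simp add: indicator_def of_bool_def)
  also have "\<dots> = (\<integral>\<^sup>+\<omega>. F \<omega> \<partial>?P)"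
  proof (rule nn_integral_cong_AE, use AE_fork_steps in eventually_elim)
    fix \<omega> :: "nat \<Rightarrow> (nat, nat) step" assume "\<forall>n. \<omega> n \<in> fork_steps n"
    then have "\<omega> 1 \<in> fork_steps 1" by blast
    then have s: "state_at fork_ma \<omega> 2 \<in> {0, 2, 3}"
      by (auto simp: state_at_def fork_steps_def numeral_2_eq_2)
    have "(\<integral>\<^sup>+x. indicator {\<omega>. hit \<omega>} (fun_upd \<omega> 2 x) \<partial>step_kernel fork_ma \<sigma> 2 \<omega>) =
        (\<integral>\<^sup>+x. indicator {\<omega>. snd (snd (\<omega> 1)) = 3} \<omega> *
          indicator {a - time_at \<omega> 2..} (fst (snd x)) \<partial>step_kernel fork_ma \<sigma> 2 \<omega>)"
    proof (rule nn_integral_cong)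
      fix x :: "(nat, nat) step"
      have "hit (fun_upd \<omega> 2 x) \<longleftrightarrow> snd (snd (\<omega> 1)) = 3 \<and> a \<le> time_at \<omega> 2 + fst (snd x)"
        by (simp only: hit_def time_upd) simp
      then show "indicator {\<omega>. hit \<omega>} (fun_upd \<omega> 2 x) = (indicator {\<omega>. snd (snd (\<omega> 1)) = 3} \<omega> *
          indicator {a - time_at \<omega> 2..} (fst (snd x)) :: ennreal)"
        by (auto simp: indicator_def)
    qed
    also have "\<dots> = (\<integral>\<^sup>+t. indicator {\<omega>. snd (snd (\<omega> 1)) = 3} \<omega> *
        indicator {a - time_at \<omega> 2..} t \<partial>exp_dist)"
      by (subst nn_integral_step_kernel_fork_markovian[OF s]) simp_all
    also have "\<dots> = F \<omega>"
      by (subst nn_integral_cmult) (simp_all add: F_def emeasure_exp_dist_atLeast numeral_2_eq_2)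
    finally show "(\<integral>\<^sup>+x. indicator {\<omega>. hit \<omega>} (fun_upd \<omega> 2 x) \<partial>step_kernel fork_ma \<sigma> 2 \<omega>) = F \<omega>" .
  qed
  also have "\<dots> = (\<integral>\<^sup>+\<omega>. \<integral>\<^sup>+x. F (fun_upd \<omega> 1 x) \<partial>step_kernel fork_ma \<sigma> 1 \<omega> \<partial>?P)"
  proof (rule nn_integral_path_measure_Suc)
    fix \<omega> \<omega>' :: "nat \<Rightarrow> (nat, nat) step" assume "\<And>i. i \<le> 1 \<Longrightarrow> \<omega> i = \<omega>' i"
    then show "F \<omega> = F \<omega>'"
      using time_cong[of "Suc 1" \<omega> \<omega>'] by (simp add: F_def indicator_def less_Suc_eq_le)
  qed (unfold F_def, measurable)
  also have "\<dots> = (\<integral>\<^sup>+\<omega>. G \<omega> \<partial>?P)"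
  proof (rule nn_integral_cong_AE, use AE_fork_steps in eventually_elim)
    fix \<omega> :: "nat \<Rightarrow> (nat, nat) step" assume "\<forall>n. \<omega> n \<in> fork_steps n"
    then have \<omega>: "\<omega> 0 \<in> fork_steps 0" by blast
    then have s: "state_at fork_ma \<omega> 1 = 1" by (auto simp: state_at_def fork_steps_def)
    have "F (fun_upd \<omega> 1 x) = indicator {3} (snd (snd x)) *
        ennreal (exp (- max 0 (a - (time_at \<omega> 1 + fst (snd x)))))" for x
      by (simp only: F_def time_upd) (simp add: indicator_def)
    then have "(\<integral>\<^sup>+x. F (fun_upd \<omega> 1 x) \<partial>step_kernel fork_ma \<sigma> 1 \<omega>) =
        (\<integral>\<^sup>+x. indicator {3} (snd (snd x)) *
          ennreal (exp (- max 0 (a - (time_at \<omega> 1 + fst (snd x))))) \<partial>step_kernel fork_ma \<sigma> 1 \<omega>)"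
      by (simp only:)
    also have "\<dots> = G \<omega>"
    proof -
      have [measurable]: "(\<lambda>x. indicator {3} (snd (snd x)) :: ennreal) \<in> borel_measurable (step_space :: (nat, nat) step measure)"
        by (rule measurable_compose[OF measurable_step_components(2)]) simp
      have "(\<lambda>x. indicator {3} (snd (snd x)) * ennreal (exp (- max 0 (a - (time_at \<omega> 1 + fst (snd x))))))
          \<in> borel_measurable (step_space :: (nat, nat) step measure)"
        by measurable
      \<comment> \<open>Of the two summands only the one of action 2 leads to state 3, and its
        sojourn time is 0, so the deadline does not come closer.\<close>
      from nn_integral_step_kernel_fork_probabilistic[where \<sigma>=\<sigma>, OF s set_pmf_scheduler[of \<omega>, OF \<omega>] this]
      show ?thesis by (simp add: G_def mult.commute)
    qed
    finally show "(\<integral>\<^sup>+x. F (fun_upd \<omega> 1 x) \<partial>step_kernel fork_ma \<sigma> 1 \<omega>) = G \<omega>" .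
  qed
  also have "\<dots> = (\<integral>\<^sup>+\<omega>. \<integral>\<^sup>+x. G (fun_upd \<omega> 0 x) \<partial>step_kernel fork_ma \<sigma> 0 \<omega> \<partial>?P)"
  proof (rule nn_integral_path_measure_Suc)
    fix \<omega> \<omega>' :: "nat \<Rightarrow> (nat, nat) step" assume "\<And>i. i \<le> 0 \<Longrightarrow> \<omega> i = \<omega>' i"
    then show "G \<omega> = G \<omega>'"
      using time_cong[of "Suc 0" \<omega> \<omega>'] by (simp add: G_def)
  qed (unfold G_def, measurable)
  also have "\<dots> = (\<integral>\<^sup>+\<omega>. \<integral>\<^sup>+t. ennreal (choice_prob t * exp (- max 0 (a - t))) \<partial>exp_dist \<partial>?P)"
  proof (rule nn_integral_cong)
    fix \<omega> :: "nat \<Rightarrow> (nat, nat) step"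
    \<comment> \<open>\<open>G\<close> depends on step 0 alone, so the constant path with value
      \<open>x\<close> can replace the updated path; the inner integral thereby becomes independent
      of \<open>\<omega>\<close>.\<close>
    have "(\<lambda>x _. x) \<in> step_space \<rightarrow>\<^sub>M ?\<Omega>"
      by (rule measurable_PiM_single') (auto simp: step_space_def space_pair_measure)
    moreover have "G \<in> borel_measurable ?\<Omega>"
      unfolding G_def by measurable
    ultimately have "(\<lambda>x. G (\<lambda>_. x)) \<in> borel_measurable step_space"
      by (rule measurable_compose)
    moreover have "G (fun_upd \<omega> 0 x) = G (\<lambda>_. x)" for x
      by (simp add: G_def time_at_def)
    ultimately have "(\<integral>\<^sup>+x. G (fun_upd \<omega> 0 x) \<partial>step_kernel fork_ma \<sigma> 0 \<omega>) =
        (\<integral>\<^sup>+t. G (\<lambda>_. (0, t, 1)) \<partial>exp_dist)"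
      by (simp add: nn_integral_step_kernel_fork_markovian state_at_def)
    also have "\<dots> = (\<integral>\<^sup>+t. ennreal (choice_prob t * exp (- max 0 (a - t))) \<partial>exp_dist)"
      by (simp add: G_def time_at_def ennreal_mult)
    finally show "(\<integral>\<^sup>+x. G (fun_upd \<omega> 0 x) \<partial>step_kernel fork_ma \<sigma> 0 \<omega>) = \<dots>" .
  qed
  also have "\<dots> = (\<integral>\<^sup>+t. ennreal (choice_prob t * exp (- max 0 (a - t))) \<partial>exp_dist)"
    by (simp add: emeasure_space_1)
  finally have *: "emeasure ?P (reach_paths fork_ma {a..} {3}) =
      (\<integral>\<^sup>+t. ennreal (choice_prob t * exp (- max 0 (a - t))) \<partial>exp_dist)" .
  have "(\<lambda>t. choice_prob t * exp (- max 0 (a - t))) \<in> borel_measurable exp_dist"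
    by measurable
  then show ?thesis
    by (subst integral_eq_nn_integral) (auto simp: reach_value_def measure_def *)
qed

end

section \<open>Every measurable decision rule comes from a scheduler\<close>

lemma path_from_fork_absorbing:
  assumes "path_from fork_ma s xs" and "s \<in> {2, 3}" and "xs \<noteq> []"
  shows "snd (snd (last xs)) = 2"
  using assms
proof (induction xs arbitrary: s)
  case (Cons x xs)
  then show ?case
    by (cases x) (fastforce simp: enabled_fork_ma succ_dist_fork_ma split: if_splits)
qed simp

text \<open>The length of a history already tells whether a decision is due, so a scheduler may
  distinguish histories by length.\<close>

lemma last_state_fork_path:
  assumes "path_from fork_ma 0 xs"
  shows "if length xs = 1 then last_state fork_ma xs = 1 else last_state fork_ma xs \<in> {0, 2, 3}"
\<comment> \<open>This rule merely splits into empty lists, singletons and lists with at least two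
  elements.\<close>
proof (cases xs rule: remdups_adj.cases)
  case (3 x y zs)
  then have "snd (snd y) \<in> {2, 3} \<and> path_from fork_ma (snd (snd y)) zs"
    using assms by (cases x; cases y)
      (auto simp: enabled_fork_ma succ_dist_fork_ma simp del: One_nat_def split: if_splits)
  then show ?thesis
    using 3 path_from_fork_absorbing[of "snd (snd y)" zs]
    by (cases "zs = []") (auto simp: last_state_def)
qed (use assms in \<open>auto simp: last_state_def enabled_fork_ma succ_dist_fork_ma\<close>)

lemma fork_scheduler_exists:
  fixes b :: "real \<Rightarrow> real"
  assumes b [measurable]: "b \<in> borel_measurable borel" and range: "\<And>t. b t \<in> {0..1}"
  obtains \<sigma> where "generic_scheduler fork_ma \<sigma>" and "\<And>t. pmf (\<sigma> [(0, t, 1)]) 2 = b t"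
proof
  \<comment> \<open>A coin with bias given by the recorded clock value decides between actions 2 and
    1. The default \<open>return_pmf 0\<close> is \<bottom>, the only action enabled after paths of
    any other length.\<close>
  define \<sigma> where "\<sigma> xs = (if length xs = 1
      then map_pmf (\<lambda>c. if c then 2 else 1 :: nat) (bernoulli_pmf (b (fst (snd (hd xs))))) else return_pmf 0)"
    for xs :: "(nat, nat) step list"
  have pmf: "pmf (map_pmf (\<lambda>c. if c then 2 else 1) (bernoulli_pmf (b t))) \<alpha> =
      (if \<alpha> = 2 then b t else if \<alpha> = 1 then 1 - b t else 0)" for t and \<alpha> :: nat
  proof -
    have "(\<lambda>c. if c then 2 else 1 :: nat) -` {\<alpha>} = (if \<alpha> = 2 then {True} else if \<alpha> = 1 then {False} else {})"
      by (auto split: if_splits)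
    then show ?thesis
      using range[of t] by (simp add: pmf_map measure_pmf_single)
  qed
  show "pmf (\<sigma> [(0, t, 1)]) 2 = b t" for t
    using pmf by (simp add: \<sigma>_def)
  show "generic_scheduler fork_ma \<sigma>"
    unfolding generic_scheduler_def
  proof (intro conjI allI impI)
    fix n \<alpha> :: nat
    show "(\<lambda>\<omega>. pmf (\<sigma> (map \<omega> [0..<n])) \<alpha>) \<in> borel_measurable (PiM {0..<n} (\<lambda>_. step_space))"
    proof (cases "n = 1")
      case True
      then have "(\<lambda>\<omega>. pmf (\<sigma> (map \<omega> [0..<n])) \<alpha>) = (\<lambda>\<omega>. if \<alpha> = 2 then b (fst (snd (\<omega> 0)))
          else if \<alpha> = 1 then 1 - b (fst (snd (\<omega> 0))) else 0)"
        by (auto simp: \<sigma>_def pmf[simplified] fun_eq_iff)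
      moreover have [measurable]: "(\<lambda>\<omega>. \<omega> 0) \<in>
          PiM {0..<n} (\<lambda>_. step_space) \<rightarrow>\<^sub>M (step_space :: (nat, nat) step measure)"
        using True by (intro measurable_component_singleton) simp
      ultimately show ?thesis by simp
    qed (simp add: \<sigma>_def)
  next
    fix xs assume "path_from fork_ma (init fork_ma) xs"
    then have "if length xs = 1 then last_state fork_ma xs = 1 else last_state fork_ma xs \<in> {0, 2, 3}"
      by (intro last_state_fork_path) simp
    then show "set_pmf (\<sigma> xs) \<subseteq> enabled fork_ma (last_state fork_ma xs)"
      by (auto simp: \<sigma>_def enabled_fork_ma split: if_splits)
  qed
qed

subsection \<open>The trade-off curve\<close>

text \<open>The probability that state \<open>3\<close>, entered at time \<open>t\<close>, is still occupied at some time \<open>\<ge> 1\<close>.\<close>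

definition stay_prob :: "real \<Rightarrow> real" where
  "stay_prob t = exp (- max 0 (1 - t))"

lemma measurable_stay_prob [measurable]: "stay_prob \<in> borel_measurable borel"
  unfolding stay_prob_def by measurable

text \<open>All that matters of a scheduler here: the probability of entering state 3 as a function
  of the clock value.\<close>

definition fork_choices :: "(real \<Rightarrow> real) set" where
  "fork_choices = {b \<in> borel_measurable borel. range b \<subseteq> {0..1}}"

lemma integrable_exp_dist_bounded:
  fixes f :: "real \<Rightarrow> real"
  assumes "f \<in> borel_measurable borel" and "\<And>t. \<bar>f t\<bar> \<le> B"
  shows "integrable exp_dist f"
proof -
  interpret prob_space exp_dist by (rule prob_space_exp_dist)
  show ?thesis
    using assms by (intro integrable_const_bound[where B=B]) auto
qed

lemma integrable_fork_choice:
  assumes "b \<in> fork_choices"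
  shows "integrable exp_dist b" and "integrable exp_dist (\<lambda>t. b t * stay_prob t)"
proof -
  have [measurable]: "b \<in> borel_measurable borel" and b: "\<bar>b t\<bar> \<le> 1" for t
    using assms by (auto simp: fork_choices_def image_subset_iff abs_le_iff intro: order_trans[of _ 0])
  moreover have "\<bar>stay_prob t\<bar> \<le> 1" for t by (simp add: stay_prob_def)
  with b have "\<bar>b t * stay_prob t\<bar> \<le> 1" for t
    by (simp add: abs_mult mult_le_one)
  ultimately show "integrable exp_dist b" "integrable exp_dist (\<lambda>t. b t * stay_prob t)"
    by (auto intro!: integrable_exp_dist_bounded[where B=1])
qed

text \<open>Replaces schedulers by decision rules: a rule is read off from a scheduler at the
  histories of length 1, and conversely \<open>fork_scheduler_exists\<close> realises any
  rule.\<close>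

lemma achieve_fork_iff:
  "achieve fork_ma 2 (\<lambda>i. ({real i..}, {3})) (\<lambda>i. if i = 0 then (\<le>) else (\<ge>)) p \<longleftrightarrow>
    (\<exists>b\<in>fork_choices. (\<integral>t. b t \<partial>exp_dist) \<le> Poly_Mapping.lookup p 0 \<and>
      Poly_Mapping.lookup p 1 \<le> (\<integral>t. b t * stay_prob t \<partial>exp_dist))"
proof -
  have val: "reach_value fork_ma \<sigma> ({0..}, {3}) = (\<integral>t. pmf (\<sigma> [(0, t, 1)]) 2 \<partial>exp_dist)"
    "reach_value fork_ma \<sigma> ({1..}, {3}) = (\<integral>t. pmf (\<sigma> [(0, t, 1)]) 2 * stay_prob t \<partial>exp_dist)"
    "(\<lambda>t. pmf (\<sigma> [(0, t, 1)]) 2) \<in> fork_choices"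
    if "generic_scheduler fork_ma \<sigma>" for \<sigma>
  proof -
    interpret scheduled_fork \<sigma> by standard fact
    \<comment> \<open>For the untimed objective the deadline 0 has almost surely passed, and the
      exponential factor is 1.\<close>
    have "(\<integral>t. choice_prob t * exp (- max 0 (0 - t)) \<partial>exp_dist) = (\<integral>t. choice_prob t \<partial>exp_dist)"
    proof (rule integral_cong_AE)
      show "AE t in exp_dist. choice_prob t * exp (- max 0 (0 - t)) = choice_prob t"
        using AE_exp_dist_nonneg by eventually_elim simp
    qed measurable
    then show "reach_value fork_ma \<sigma> ({0..}, {3}) = (\<integral>t. choice_prob t \<partial>exp_dist)"
      by (simp only: reach_value_fork order_refl)
    show "reach_value fork_ma \<sigma> ({1..}, {3}) = (\<integral>t. choice_prob t * stay_prob t \<partial>exp_dist)"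
      by (simp only: reach_value_fork stay_prob_def zero_le_one)
    show "choice_prob \<in> fork_choices"
      using measurable_choice_prob by (auto simp: fork_choices_def pmf_le_1)
  qed
  have "achieve fork_ma 2 (\<lambda>i. ({real i..}, {3})) (\<lambda>i. if i = 0 then (\<le>) else (\<ge>)) p \<longleftrightarrow>
      (\<exists>\<sigma>. generic_scheduler fork_ma \<sigma> \<and> reach_value fork_ma \<sigma> ({0..}, {3}) \<le> Poly_Mapping.lookup p 0 \<and>
        Poly_Mapping.lookup p 1 \<le> reach_value fork_ma \<sigma> ({1..}, {3}))"
    unfolding achieve_def by (simp add: numeral_2_eq_2 All_less_Suc conj_commute)
  also have "\<dots> \<longleftrightarrow> (\<exists>b\<in>fork_choices. (\<integral>t. b t \<partial>exp_dist) \<le> Poly_Mapping.lookup p 0 \<and>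
      Poly_Mapping.lookup p 1 \<le> (\<integral>t. b t * stay_prob t \<partial>exp_dist))"
  proof safe
    fix \<sigma> assume \<sigma>: "generic_scheduler fork_ma \<sigma>"
      and "reach_value fork_ma \<sigma> ({0..}, {3}) \<le> Poly_Mapping.lookup p 0"
        "Poly_Mapping.lookup p 1 \<le> reach_value fork_ma \<sigma> ({1..}, {3})"
    then show "\<exists>b\<in>fork_choices. (\<integral>t. b t \<partial>exp_dist) \<le> Poly_Mapping.lookup p 0 \<and>
        Poly_Mapping.lookup p 1 \<le> (\<integral>t. b t * stay_prob t \<partial>exp_dist)"
      unfolding val[OF \<sigma>] using val(3)[OF \<sigma>] by (intro bexI conjI)
  next
    fix b assume b: "b \<in> fork_choices" "(\<integral>t. b t \<partial>exp_dist) \<le> Poly_Mapping.lookup p 0"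
      "Poly_Mapping.lookup p 1 \<le> (\<integral>t. b t * stay_prob t \<partial>exp_dist)"
    from b(1) have "b \<in> borel_measurable borel" "\<And>t. b t \<in> {0..1}"
      by (auto simp: fork_choices_def image_subset_iff)
    then obtain \<sigma> where \<sigma>: "generic_scheduler fork_ma \<sigma>" and pmf: "\<And>t. pmf (\<sigma> [(0, t, 1)]) 2 = b t"
      by (rule fork_scheduler_exists) blast
    from b(2,3) show "\<exists>\<sigma>. generic_scheduler fork_ma \<sigma> \<and>
        reach_value fork_ma \<sigma> ({0..}, {3}) \<le> Poly_Mapping.lookup p 0 \<and>
        Poly_Mapping.lookup p 1 \<le> reach_value fork_ma \<sigma> ({1..}, {3})"
      by (intro exI[of _ \<sigma>]) (simp only: \<sigma> val[OF \<sigma>] pmf simp_thms)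
  qed
  finally show ?thesis .
qed

lemma measure_exp_dist_atLeast: "0 \<le> c \<Longrightarrow> measure exp_dist {c..} = exp (- c)"
  using emeasure_exp_dist_atLeast[of c] by (simp add: measure_def max_absorb2)

lemma integral_late_choice_stay:
  assumes "0 \<le> c" "c \<le> 1"
  shows "(\<integral>t. indicator {c..} t * stay_prob t \<partial>exp_dist) = exp (- 1) * (2 - c)"
proof -
  have "(\<integral>t. indicator {c..} t * stay_prob t \<partial>exp_dist) =
      (\<integral>t. exponential_density 1 t * (indicator {c..} t * stay_prob t) \<partial>lborel)"
    by (subst integral_density) auto
  \<comment> \<open>Before time 1 the decay of the density cancels the growth of
    \<open>stay_prob\<close>, leaving the constant \<open>exp (- 1)\<close>; from time 1 on
    \<open>stay_prob\<close> is 1.\<close>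
  also have "\<dots> = (\<integral>t. exp (- 1) * indicator {c..<1} t + exponential_density 1 t * indicator {1..} t \<partial>lborel)"
    using assms
    by (intro Bochner_Integration.integral_cong)
      (auto simp: indicator_def exponential_density_def stay_prob_def max_def simp flip: exp_add)
  also have "\<dots> = (\<integral>t. exp (- 1) * indicator {c..<1} t \<partial>lborel) +
      (\<integral>t. exponential_density 1 t * indicator {1..} t \<partial>lborel)"
  proof (rule Bochner_Integration.integral_add)
    show "integrable lborel (\<lambda>t. exp (- 1) * indicator {c..<1} t :: real)"
      using assms by (intro integrable_mult_right integrable_real_indicator) auto
    have "integrable exp_dist (indicator {1..} :: real \<Rightarrow> real)"
      by (rule integrable_exp_dist_bounded[where B=1]) (auto simp: indicator_def)
    then show "integrable lborel (\<lambda>t. exponential_density 1 t * indicator {1..} t)"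
      by (subst (asm) integrable_density) auto
  qed
  also have "(\<integral>t. exponential_density 1 t * indicator {1..} t \<partial>lborel) = exp (- 1)"
  proof -
    have "(\<integral>t. indicator {1..} t \<partial>exp_dist) = (exp (- 1) :: real)"
      by (simp add: measure_exp_dist_atLeast)
    then show ?thesis by (subst (asm) integral_density) auto
  qed
  also have "(\<integral>t. exp (- 1) * indicator {c..<1} t \<partial>lborel) = exp (- 1) * (1 - c)"
    using assms by simp
  finally show ?thesis by (simp add: algebra_simps)
qed

text \<open>The functional integrates \<open>b t * (stay_prob t - exp (c - 1))\<close>. Since
  \<open>stay_prob\<close> is monotone with value \<open>exp (c - 1)\<close> at \<open>c\<close>,
  the second factor changes sign at \<open>c\<close>, and the best \<open>b\<close> is pointwise the
  indicator of \<open>{c..}\<close>.\<close>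

lemma late_choice_optimal:
  assumes b: "b \<in> fork_choices" and c: "0 \<le> c" "c \<le> 1"
  shows "(\<integral>t. b t * stay_prob t \<partial>exp_dist) - exp (c - 1) * (\<integral>t. b t \<partial>exp_dist) \<le> exp (- 1) * (1 - c)"
proof -
  have late: "indicator {c..} \<in> fork_choices"
    by (auto simp: fork_choices_def indicator_def)
  have range: "0 \<le> b t" "b t \<le> 1" for t
    using b by (auto simp: fork_choices_def image_subset_iff)
  have "(\<integral>t. b t * stay_prob t \<partial>exp_dist) - exp (c - 1) * (\<integral>t. b t \<partial>exp_dist) =
      (\<integral>t. b t * stay_prob t - exp (c - 1) * b t \<partial>exp_dist)"
    using integrable_fork_choice[OF b] by simp
  also have "\<dots> \<le> (\<integral>t. indicator {c..} t * stay_prob t - exp (c - 1) * indicator {c..} t \<partial>exp_dist)"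
  proof (rule integral_mono)
    fix t
    have "b t * (stay_prob t - exp (c - 1)) \<le> indicator {c..} t * (stay_prob t - exp (c - 1))"
    proof (cases "c \<le> t")
      case True
      then have "exp (c - 1) \<le> stay_prob t" using c by (simp add: stay_prob_def)
      then show ?thesis using True range[of t] by (simp add: mult_left_le_one_le)
    next
      case False
      then have "stay_prob t \<le> exp (c - 1)" using c by (simp add: stay_prob_def)
      then show ?thesis using False range[of t] by (simp add: mult_nonneg_nonpos)
    qed
    then show "b t * stay_prob t - exp (c - 1) * b t \<le>
        indicator {c..} t * stay_prob t - exp (c - 1) * indicator {c..} t"
      by (simp add: algebra_simps)
  qed (use integrable_fork_choice[OF b] integrable_fork_choice[OF late] in auto)
  also have "\<dots> = exp (- 1) * (2 - c) - exp (c - 1) * exp (- c)"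
    using integrable_fork_choice[OF late] c
    by (simp add: integral_late_choice_stay measure_exp_dist_atLeast)
  also have "\<dots> = exp (- 1) * (1 - c)"
    by (simp add: algebra_simps flip: exp_add)
  finally show ?thesis .
qed

subsection \<open>Supporting functionals of finite polytopes\<close>

lemma lookup_scaleR: "Poly_Mapping.lookup (r *\<^sub>R p) i = r *\<^sub>R Poly_Mapping.lookup p i"
  by (simp add: scaleR_poly_mapping_def)

lemma bounded_linear_lookup: "bounded_linear (\<lambda>p :: 'a \<Rightarrow>\<^sub>0 'b::real_normed_vector. Poly_Mapping.lookup p i)"
proof (rule bounded_linear_intro[where K=1])
  fix p :: "'a \<Rightarrow>\<^sub>0 'b"
  show "norm (Poly_Mapping.lookup p i) \<le> norm p * 1"
  proof (cases "i \<in> Poly_Mapping.keys p")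
    case True
    then have "norm (Poly_Mapping.lookup p i) \<le> (\<Sum>n\<in>Poly_Mapping.keys p. norm (Poly_Mapping.lookup p n))"
      by (intro member_le_sum) auto
    then show ?thesis
      by (simp add: norm_poly_mapping_def dist_poly_mapping_def)
  qed (simp add: in_keys_iff)
qed (simp_all add: lookup_add lookup_scaleR)

lemma closure_bounded_linear_le:
  fixes f :: "'a::real_normed_vector \<Rightarrow> real"
  assumes "bounded_linear f" and "\<And>x. x \<in> X \<Longrightarrow> f x \<le> m" and "x \<in> closure X"
  shows "f x \<le> m"
proof -
  have "closure X \<subseteq> {x. f x \<le> m}"
    using assms(1,2)
    by (intro closure_minimal closed_Collect_le) (auto intro: linear_continuous_on)
  with assms(3) show ?thesis by blast
qed

text \<open>Decompose a maximal point as \<open>p = v + r\<close>. The cone part \<open>r\<close>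
  cannot contribute to the maximum, and on the convex hull a linear functional is at most its
  largest value on \<open>V\<close>. That \<open>V\<close> lies in the closure carries bounds valid
  on \<open>X\<close> over to the vertices.\<close>

lemma finite_polytope_maximal_vertex:
  fixes X :: "'a::real_normed_vector set"
  assumes "finite_polytope X"
  obtains V where "finite V" "V \<subseteq> closure X"
    "\<forall>f p. bounded_linear f \<and> p \<in> X \<and> (\<forall>x\<in>X. f x \<le> f p) \<longrightarrow> (\<exists>v\<in>V. f v = (f p :: real))"
proof -
  from assms obtain V D where V: "finite V"
    and cl: "closure X = {v + r |v r. v \<in> convex hull V \<and> r \<in> convex_cone hull D}"
    by (auto simp: finite_polytope_def)
  have hull: "v \<in> closure X" if "v \<in> convex hull V" for v
    using that convex_cone_hull_contains_0[of D] unfolding cl by force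
  then have sub: "V \<subseteq> closure X" by (auto intro: hull_inc)
  have "\<exists>v\<in>V. f v = f p"
    if f: "bounded_linear f" and p: "p \<in> X" and max: "\<forall>x\<in>X. f x \<le> f p"
    for f :: "'a \<Rightarrow> real" and p
  proof -
    interpret f: bounded_linear f by fact
    have le: "f x \<le> f p" if "x \<in> closure X" for x
      by (rule closure_bounded_linear_le[OF f _ that]) (use max in blast)
    have "p \<in> closure X" using p closure_subset by blast
    then obtain v r where vr: "p = v + r" "v \<in> convex hull V" "r \<in> convex_cone hull D"
      unfolding cl by blast
    then have "v + (r + r) \<in> closure X"
      unfolding cl by (blast intro: convex_cone_hull_add)
    \<comment> \<open>moving twice as far in direction \<open>r\<close> must not increase \<open>f\<close>\<close>
    from le[OF this] have "f r \<le> 0" by (simp add: vr f.add)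
    then have "f p \<le> f v" by (simp add: vr f.add)
    moreover obtain w where w: "w \<in> V" "f v \<le> f w"
    proof (rule ccontr)
      assume "\<not> thesis"
      \<comment> \<open>If all vertices lay in this open half-space, so would their convex hull, and
        in particular \<open>v\<close>.\<close>
      then have "V \<subseteq> f -` {..<f v}" using that by force
      moreover have "convex (f -` {..<f v})"
        by (intro convex_linear_vimage f.linear_axioms convex_real_interval)
      ultimately have "convex hull V \<subseteq> f -` {..<f v}" by (rule hull_minimal)
      with vr(2) show False by auto
    qed
    moreover have "f w \<le> f p" using le sub w(1) by blast
    ultimately show ?thesis by (intro bexI[OF _ w(1)]) simp
  qed
  with V sub show thesis by (intro that) auto
qed

section \<open>Convexity of the achievable set, and infinitely many supporting slopes\<close>

theorem theorem2:
  shows "\<exists>(M :: (nat, nat) ma) (d :: nat) (Os :: nat \<Rightarrow> real set \<times> nat set)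
            (rel :: nat \<Rightarrow> real \<Rightarrow> real \<Rightarrow> bool).
           markov_automaton M \<and>
           (\<forall>i<d. reach_objective M (Os i)) \<and>
           (\<forall>i<d. rel i \<in> {(<), (\<le>), (>), (\<ge>)}) \<and>
           convex (achievable M d Os rel) \<and>
           \<not> finite_polytope (achievable M d Os rel)"
proof (intro exI conjI)
  let ?rel = "\<lambda>i::nat. if i = 0 then (\<le>) else (\<ge>) :: real \<Rightarrow> real \<Rightarrow> bool"
  let ?X = "achievable fork_ma 2 (\<lambda>i. ({real i..}, {3})) ?rel"
  have mem: "p \<in> ?X \<longleftrightarrow> Poly_Mapping.keys p \<subseteq> {..<2} \<and>
    (\<exists>b\<in>fork_choices. (\<integral>t. b t \<partial>exp_dist) \<le> Poly_Mapping.lookup p 0 \<and>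
      Poly_Mapping.lookup p 1 \<le> (\<integral>t. b t * stay_prob t \<partial>exp_dist))" for p
    by (simp only: achievable_def achieve_fork_iff mem_Collect_eq)
  show "markov_automaton fork_ma" by (rule markov_automaton_fork_ma)
  show "\<forall>i<2. reach_objective fork_ma ({real i..}, {3})"
    by (auto simp: reach_objective_def fork_ma_def)
  show "\<forall>i<2. ?rel i \<in> {(<), (\<le>), (>), (\<ge>)}" by auto
  show "convex ?X"
  proof (rule convexI)
    fix p q and u v :: real
    assume "p \<in> ?X" "q \<in> ?X" and uv: "0 \<le> u" "0 \<le> v" "u + v = 1"
    then obtain b b' where keys: "Poly_Mapping.keys p \<subseteq> {..<2}" "Poly_Mapping.keys q \<subseteq> {..<2}"
      and b: "b \<in> fork_choices" "b' \<in> fork_choices"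
      and p: "(\<integral>t. b t \<partial>exp_dist) \<le> Poly_Mapping.lookup p 0"
        "Poly_Mapping.lookup p 1 \<le> (\<integral>t. b t * stay_prob t \<partial>exp_dist)"
      and q: "(\<integral>t. b' t \<partial>exp_dist) \<le> Poly_Mapping.lookup q 0"
        "Poly_Mapping.lookup q 1 \<le> (\<integral>t. b' t * stay_prob t \<partial>exp_dist)"
      unfolding mem by blast
    \<comment> \<open>Both integrals are linear in the decision rule, so mixing the rules mixes the
      bounds.\<close>
    let ?b = "\<lambda>t. u * b t + v * b' t"
    have "Poly_Mapping.keys (u *\<^sub>R p + v *\<^sub>R q) \<subseteq> {..<2}"
      using keys by (auto simp: in_keys_iff subset_iff lookup_add lookup_scaleR)
        (metis add.right_neutral mult_zero_right)
    moreover have "?b \<in> fork_choices"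
    proof -
      have "u * b t + v * b' t \<le> 1" for t
        using b uv convex_bound_le[of "b t" 1 "b' t" u v] by (auto simp: fork_choices_def image_subset_iff)
      with b uv show ?thesis by (auto simp: fork_choices_def image_subset_iff)
    qed
    moreover have "(\<integral>t. ?b t \<partial>exp_dist) = u * (\<integral>t. b t \<partial>exp_dist) + v * (\<integral>t. b' t \<partial>exp_dist)"
      using b[THEN integrable_fork_choice(1)] by simp
    moreover have "(\<integral>t. ?b t * stay_prob t \<partial>exp_dist) =
        u * (\<integral>t. b t * stay_prob t \<partial>exp_dist) + v * (\<integral>t. b' t * stay_prob t \<partial>exp_dist)"
      using b[THEN integrable_fork_choice(2)] by (simp add: distrib_right mult.assoc)
    ultimately show "u *\<^sub>R p + v *\<^sub>R q \<in> ?X"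
      using p q uv unfolding mem
      by (intro conjI bexI[of _ ?b]) (auto simp: lookup_add lookup_scaleR intro!: add_mono mult_left_mono)
  qed
  show "\<not> finite_polytope ?X"
  proof
    assume "finite_polytope ?X"
    then obtain V where V: "finite V" "V \<subseteq> closure ?X"
      and vertex: "\<forall>f p. bounded_linear f \<and> p \<in> ?X \<and> (\<forall>x\<in>?X. f x \<le> f p) \<longrightarrow>
        (\<exists>v\<in>V. f v = (f p :: real))"
      by (rule finite_polytope_maximal_vertex)
    define f where "f c p = Poly_Mapping.lookup p 1 - exp (c - 1) * Poly_Mapping.lookup p 0"
      for c :: real and p :: "nat \<Rightarrow>\<^sub>0 real"
    have lin: "bounded_linear (f c)" for c
      unfolding f_def
      by (intro bounded_linear_sub bounded_linear_const_mult bounded_linear_lookup)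
    have f_le: "f c p \<le> exp (- 1) * (1 - c)" if "p \<in> ?X" "c \<in> {0<..<1}" for c p
    proof -
      from that obtain b where b: "b \<in> fork_choices" "(\<integral>t. b t \<partial>exp_dist) \<le> Poly_Mapping.lookup p 0"
        "Poly_Mapping.lookup p 1 \<le> (\<integral>t. b t * stay_prob t \<partial>exp_dist)"
        unfolding mem by blast
      have "f c p \<le> (\<integral>t. b t * stay_prob t \<partial>exp_dist) - exp (c - 1) * (\<integral>t. b t \<partial>exp_dist)"
        unfolding f_def using b by (intro diff_mono mult_left_mono) auto
      also have "\<dots> \<le> exp (- 1) * (1 - c)"
        using that b by (intro late_choice_optimal) auto
      finally show ?thesis .
    qed
    have "exp (- c) \<in> (\<lambda>v. Poly_Mapping.lookup v 0) ` V" if c: "c \<in> {0<..<1}" for c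
    proof -
      \<comment> \<open>The point realised by entering state 3 iff the clock value is at least
        \<open>c\<close>; it attains the bound \<open>f_le\<close>.\<close>
      define p where "p = Poly_Mapping.single 0 (exp (- c)) + Poly_Mapping.single (1::nat) (exp (- 1) * (2 - c))"
      have p: "Poly_Mapping.lookup p 0 = exp (- c)" "Poly_Mapping.lookup p 1 = exp (- 1) * (2 - c)"
        by (simp_all add: p_def lookup_add lookup_single)
      have "Poly_Mapping.keys p \<subseteq> {..<2}"
        by (auto simp: p_def in_keys_iff lookup_add lookup_single when_def split: if_splits)
      moreover have "indicator {c..} \<in> fork_choices"
        by (auto simp: fork_choices_def indicator_def)
      ultimately have "p \<in> ?X"
        using c unfolding mem p
        by (intro conjI bexI[of _ "indicator {c..}"])
          (auto simp: integral_late_choice_stay measure_exp_dist_atLeast)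
      moreover have fp: "f c p = exp (- 1) * (1 - c)"
        unfolding f_def p by (simp add: algebra_simps flip: exp_add)
      ultimately obtain v where v: "v \<in> V" "f c v = exp (- 1) * (1 - c)"
        using vertex[rule_format, of "f c" p] lin[of c] f_le[OF _ c] by auto
      \<comment> \<open>Now \<open>v\<close> is fixed and the slope varies. As \<open>v\<close> lies
        in the closure, \<open>f_le\<close> makes \<open>?g\<close> nonnegative on the open unit
        interval, and it vanishes at \<open>c\<close>; so \<open>c\<close> is an interior minimum
        and the derivative is 0 there.\<close>
      let ?g = "\<lambda>c. exp (- 1) * (1 - c) - f c v"
      have "?g c \<le> ?g c'" if "c' \<in> {0<..<1}" for c'
        using closure_bounded_linear_le[OF lin f_le[OF _ that], of ?X v] v V by auto
      moreover have "(?g has_real_derivative - exp (- 1) + exp (c - 1) * Poly_Mapping.lookup v 0) (at c)"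
        unfolding f_def by (auto intro!: derivative_eq_intros)
      \<comment> \<open>The radius \<open>min c (1 - c)\<close> keeps the neighbourhood of
        \<open>c\<close> inside the unit interval.\<close>
      ultimately have "- exp (- 1) + exp (c - 1) * Poly_Mapping.lookup v 0 = 0"
        using c by (intro DERIV_local_min[of ?g _ c "min c (1 - c)"]) (auto simp: abs_if split: if_splits)
      then have "Poly_Mapping.lookup v 0 = exp (- c)"
        by (simp add: exp_diff exp_minus field_simps)
      with v show ?thesis by force
    qed
    then have "(\<lambda>c. exp (- c)) ` {0<..<1::real} \<subseteq> (\<lambda>v. Poly_Mapping.lookup v 0) ` V" by blast
    then have "finite ((\<lambda>c. exp (- c)) ` {0<..<1::real})"
      using V(1) by (rule finite_subset[OF _ finite_imageI])
    then have "finite {0<..<1::real}"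
      by (rule finite_imageD) (simp add: inj_on_def)
    then show False by (simp add: infinite_Ioo)
  qed
qed

end
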